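(* Let $\mathcal{T}$ be a triangulated category that admits weakly functorial octahedra. If a map of triangles in $\mathcal{T}$ of the form $(f,g,0)$ is good, then it is Verdier good.
   Context: $\mathcal{T}$ is a triangulated category with self-equivalence $\Sigma$. "Exact triangle" or "triangle" means distinguished triangle. A map of triangles $(f,g,h)$ from $X\xrightarrow{u}Y\xrightarrow{v}Z\xrightarrow{w}\Sigma X$ to $X'\xrightarrow{u'}Y'\xrightarrow{v'}Z'\xrightarrow{w'}\Sigma X'$ consists of $f\colon X\to X'$, $g\colon Y\to Y'$, $h\colon Z\to Z'$ with $gu=u'f$, $hv=v'g$, $(\Sigma f)w=w'h$. The mapping cone of $(f,g,h)$ is the sequence $X'\oplus Y\to Y'\oplus Z\to Z'\oplus\Sigma X\to\Sigma X'\oplus\Sigma Y$ with successive maps $\begin{bmatrix}u'&g \\ 0&-v\end{bmatrix},\begin{bmatrix}v'&h \\ 0&-w\end{bmatrix},\begin{bmatrix}w'&\Sigma f \\ 0&-\Sigma u\end{bmatrix}$ (acting on column vectors). $(f,g,h)$ is good if its mapping cone is an exact triangle. Octahedra: given composable maps $P\xrightarrow{a}Q\xrightarrow{b}R$ and exact triangles $P\xrightarrow{a}Q\xrightarrow{a'}C_a\xrightarrow{a''}\Sigma P$, $Q\xrightarrow{b}R\xrightarrow{b'}C_b\xrightarrow{b''}\Sigma Q$, $P\xrightarrow{ba}R\xrightarrow{c'}C\xrightarrow{c''}\Sigma P$, an octahedron for the composite $ba$ consists of maps $\alpha\colon C_a\to C$, $\beta\colon C\to C_b$, $\gamma\colon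 C_b\to\Sigma C_a$ such that $C_a\xrightarrow{\alpha}C\xrightarrow{\beta}C_b\xrightarrow{\gamma}\Sigma C_a$ is exact and $\alpha a'=c'b$, $c''\alpha=a''$, $\beta c'=b'$, $\gamma=(\Sigma a')b''$, $b''\beta=(\Sigma a)c''$. Verdier good: choose exact triangles $X\xrightarrow{f}X'\xrightarrow{f'}X''\xrightarrow{f''}\Sigma X$, $Y\xrightarrow{g}Y'\xrightarrow{g'}Y''\xrightarrow{g''}\Sigma Y$ and $X\xrightarrow{gu=u'f}Y'\xrightarrow{\tilde v}A\xrightarrow{\tilde w}\Sigma X$. The map $(f,g,h)$ is Verdier good if there exist an octahedron $(\alpha_1\colon Z\to A,\ \beta_1\colon A\to Y'',\ \gamma_1)$ for the composite $X\xrightarrow{u}Y\xrightarrow{g}Y'$ and an octahedron $(\alpha_2\colon X''\to A,\ \beta_2\colon A\to Z',\ \gamma_2)$ for the composite $X\xrightarrow{f}X'\xrightarrow{u'}Y'$ (both using the given and chosen triangles, in particular the same triangle on $gu=u'f$) such that $h=\beta_2\alpha_1$. This does not depend on the chosen triangles. Weakly functorial octahedra: an octahedron based on $P\xrightarrow{a}Q\xrightarrow{b}R$ means a choice of three exact triangles $P\xrightarrow{a}Q\xrightarrow{a'}C_a\xrightarrow{a''}\Sigma P$, $Q\xrightarrow{b}R\xrightarrow{b'}C_b\xrightarrow{b''}\Sigma Q$, $P\xrightarrow{ba}R\xrightarrow{c'}C\xrightarrow{c''}\Sigma P$ on $a$, $b$, $ba$, together with maps $\alpha\colon C_a\to C$,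 $\beta\colon C\to C_b$, $\gamma\colon C_b\to\Sigma C_a$ forming an octahedron for the composite $ba$, i.e. such that $C_a\xrightarrow{\alpha}C\xrightarrow{\beta}C_b\xrightarrow{\gamma}\Sigma C_a$ is exact and $\alpha a'=c'b$, $c''\alpha=a''$, $\beta c'=b'$, $\gamma=(\Sigma a')b''$, $b''\beta=(\Sigma a)c''$. A map of octahedra, from one based on $P_1\to P_2\to P_3$ to one based on $Q_1\to Q_2\to Q_3$, consists of maps between corresponding objects (the three base objects and the three cofibres $C_a,C_b,C$) that commute with all the structure maps of the octahedra (using suspensions of the components on suspended objects). $\mathcal{T}$ admits weakly functorial octahedra if for every commutative diagram given by $X_1\xrightarrow{f_1}X_2\xrightarrow{f_2}X_3$, $Y_1\xrightarrow{g_1}Y_2\xrightarrow{g_2}Y_3$ and $\varphi_i\colon X_i\to Y_i$ ($i=1,2,3$) with $\varphi_2f_1=g_1\varphi_1$, $\varphi_3f_2=g_2\varphi_2$, there exist octahedra $\mathcal{X}$ and $\mathcal{Y}$ based on $X_1\to X_2\to X_3$ and $Y_1\to Y_2\to Y_3$ respectively and a map of octahedra $\mathcal{X}\to\mathcal{Y}$ extending $(\varphi_1,\varphi_2,\varphi_3)$. *)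

theory Defs
  imports "HOL-Algebra.Group"
begin

section \<open>Categories and functors\<close>

record ('o, 'm) cat =
  Obj :: "'o set"
  Arr :: "'m set"
  Dom :: "'m \<Rightarrow> 'o"
  Cod :: "'m \<Rightarrow> 'o"
  Id :: "'o \<Rightarrow> 'm"
  Comp :: "'m \<Rightarrow> 'm \<Rightarrow> 'm" (infixl \<open>\<cdot>\<index>\<close> 70)

definition Hom :: "('o, 'm, 'x) cat_scheme \<Rightarrow> 'o \<Rightarrow> 'o \<Rightarrow> 'm set" where
  "Hom C X Y = {f \<in> Arr C. Dom C f = X \<and> Cod C f = Y}"

locale category =
  fixes C :: "('o, 'm, 'x) cat_scheme" (structure)
  assumes Dom_in_Obj: "f \<in> Arr C \<Longrightarrow> Dom C f \<in> Obj C"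
    and Cod_in_Obj: "f \<in> Arr C \<Longrightarrow> Cod C f \<in> Obj C"
    and Id_in_Hom: "X \<in> Obj C \<Longrightarrow> Id C X \<in> Hom C X X"
    and Comp_in_Hom: "f \<in> Hom C X Y \<Longrightarrow> g \<in> Hom C Y Z \<Longrightarrow> g \<cdot> f \<in> Hom C X Z"
    and Comp_assoc: "f \<in> Hom C W X \<Longrightarrow> g \<in> Hom C X Y \<Longrightarrow> h \<in> Hom C Y Z
      \<Longrightarrow> (h \<cdot> g) \<cdot> f = h \<cdot> (g \<cdot> f)"
    and Id_left: "f \<in> Hom C X Y \<Longrightarrow> Id C Y \<cdot> f = f"
    and Id_right: "f \<in> Hom C X Y \<Longrightarrow> f \<cdot> Id C X = f"

definition is_iso :: "('o, 'm, 'x) cat_scheme \<Rightarrow> 'm \<Rightarrow> bool" where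
  "is_iso C f \<longleftrightarrow> f \<in> Arr C \<and>
     (\<exists>g \<in> Hom C (Cod C f) (Dom C f).
        g \<cdot>\<^bsub>C\<^esub> f = Id C (Dom C f) \<and> f \<cdot>\<^bsub>C\<^esub> g = Id C (Cod C f))"

definition zero_object :: "('o, 'm, 'x) cat_scheme \<Rightarrow> 'o \<Rightarrow> bool" where
  "zero_object C Z \<longleftrightarrow> Z \<in> Obj C \<and>
     (\<forall>X \<in> Obj C. (\<exists>!f. f \<in> Hom C X Z) \<and> (\<exists>!f. f \<in> Hom C Z X))"

definition is_functor ::
  "('o, 'm, 'x) cat_scheme \<Rightarrow> ('p, 'n, 'y) cat_scheme \<Rightarrow> ('o \<Rightarrow> 'p) \<Rightarrow> ('m \<Rightarrow> 'n) \<Rightarrow> bool"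
where
  "is_functor C D Fo Fm \<longleftrightarrow>
     (\<forall>X \<in> Obj C. Fo X \<in> Obj D \<and> Fm (Id C X) = Id D (Fo X)) \<and>
     (\<forall>X Y. \<forall>f \<in> Hom C X Y. Fm f \<in> Hom D (Fo X) (Fo Y)) \<and>
     (\<forall>X Y Z. \<forall>f \<in> Hom C X Y. \<forall>g \<in> Hom C Y Z. Fm (g \<cdot>\<^bsub>C\<^esub> f) = Fm g \<cdot>\<^bsub>D\<^esub> Fm f)"

definition natural_iso ::
  "('o, 'm, 'x) cat_scheme \<Rightarrow> ('p, 'n, 'y) cat_scheme \<Rightarrow> ('o \<Rightarrow> 'p) \<Rightarrow> ('m \<Rightarrow> 'n)
     \<Rightarrow> ('o \<Rightarrow> 'p) \<Rightarrow> ('m \<Rightarrow> 'n) \<Rightarrow> ('o \<Rightarrow> 'n) \<Rightarrow> bool"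
where
  "natural_iso C D Fo Fm Go Gm \<eta> \<longleftrightarrow>
     (\<forall>X \<in> Obj C. \<eta> X \<in> Hom D (Fo X) (Go X) \<and> is_iso D (\<eta> X)) \<and>
     (\<forall>X Y. \<forall>f \<in> Hom C X Y. \<eta> Y \<cdot>\<^bsub>D\<^esub> Fm f = Gm f \<cdot>\<^bsub>D\<^esub> \<eta> X)"

definition equivalence_functor ::
  "('o, 'm, 'x) cat_scheme \<Rightarrow> ('p, 'n, 'y) cat_scheme \<Rightarrow> ('o \<Rightarrow> 'p) \<Rightarrow> ('m \<Rightarrow> 'n) \<Rightarrow> bool"
where
  "equivalence_functor C D Fo Fm \<longleftrightarrow> is_functor C D Fo Fm \<and>
     (\<exists>Go Gm \<eta> \<epsilon>. is_functor D C Go Gm \<and>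
        natural_iso C C id id (Go \<circ> Fo) (Gm \<circ> Fm) \<eta> \<and>
        natural_iso D D (Fo \<circ> Go) (Fm \<circ> Gm) id id \<epsilon>)"


section \<open>Additive categories\<close>

record ('o, 'm) preadd_cat = "('o, 'm) cat" +
  Add :: "'m \<Rightarrow> 'm \<Rightarrow> 'm" (infixl \<open>\<boxplus>\<index>\<close> 65)
  Zero :: "'o \<Rightarrow> 'o \<Rightarrow> 'm"

definition hom_group :: "('o, 'm, 'x) preadd_cat_scheme \<Rightarrow> 'o \<Rightarrow> 'o \<Rightarrow> 'm monoid" where
  "hom_group C X Y = \<lparr>carrier = Hom C X Y, mult = Add C, one = Zero C X Y\<rparr>"

definition Neg :: "('o, 'm, 'x) preadd_cat_scheme \<Rightarrow> 'm \<Rightarrow> 'm" where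
  "Neg C f = inv\<^bsub>hom_group C (Dom C f) (Cod C f)\<^esub> f"

text \<open>A direct sum together with its injections and projections.\<close>

datatype ('o, 'm) biprod =
  Biprod (sum_obj: 'o) (inj1: 'm) (inj2: 'm) (proj1: 'm) (proj2: 'm)

fun is_biproduct ::
  "('o, 'm, 'x) preadd_cat_scheme \<Rightarrow> 'o \<Rightarrow> 'o \<Rightarrow> ('o, 'm) biprod \<Rightarrow> bool"
where
  "is_biproduct C A B (Biprod S i j p q) \<longleftrightarrow>
     i \<in> Hom C A S \<and> j \<in> Hom C B S \<and> p \<in> Hom C S A \<and> q \<in> Hom C S B \<and>
     p \<cdot>\<^bsub>C\<^esub> i = Id C A \<and> q \<cdot>\<^bsub>C\<^esub> j = Id C B \<and>
     q \<cdot>\<^bsub>C\<^esub> i = Zero C A B \<and> p \<cdot>\<^bsub>C\<^esub> j = Zero C B A \<and>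
     (i \<cdot>\<^bsub>C\<^esub> p) \<boxplus>\<^bsub>C\<^esub> (j \<cdot>\<^bsub>C\<^esub> q) = Id C S"

locale additive_category = category C
  for C :: "('o, 'm, 'x) preadd_cat_scheme" (structure) +
  assumes hom_comm_group: "X \<in> Obj C \<Longrightarrow> Y \<in> Obj C \<Longrightarrow> comm_group (hom_group C X Y)"
    and Comp_Add_right: "f \<in> Hom C X Y \<Longrightarrow> f' \<in> Hom C X Y \<Longrightarrow> g \<in> Hom C Y Z
      \<Longrightarrow> g \<cdot> (f \<boxplus> f') = (g \<cdot> f) \<boxplus> (g \<cdot> f')"
    and Comp_Add_left: "f \<in> Hom C X Y \<Longrightarrow> g \<in> Hom C Y Z \<Longrightarrow> g' \<in> Hom C Y Z
      \<Longrightarrow> (g \<boxplus> g') \<cdot> f = (g \<cdot> f) \<boxplus> (g' \<cdot> f)"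
    and ex_zero_object: "\<exists>Z. zero_object C Z"
    and ex_biproduct: "A \<in> Obj C \<Longrightarrow> B \<in> Obj C \<Longrightarrow> \<exists>S. is_biproduct C A B S"

text \<open>
  The map between two direct sums given, on column vectors, by the matrix with rows
  \<open>a b\<close> and \<open>c d\<close>.
\<close>

definition matrix_map ::
  "('o, 'm, 'x) preadd_cat_scheme \<Rightarrow> ('o, 'm) biprod \<Rightarrow> ('o, 'm) biprod
     \<Rightarrow> 'm \<Rightarrow> 'm \<Rightarrow> 'm \<Rightarrow> 'm \<Rightarrow> 'm"
where
  "matrix_map C S S' a b c d =
     ((inj1 S' \<cdot>\<^bsub>C\<^esub> a \<cdot>\<^bsub>C\<^esub> proj1 S) \<boxplus>\<^bsub>C\<^esub> (inj1 S' \<cdot>\<^bsub>C\<^esub> b \<cdot>\<^bsub>C\<^esub> proj2 S)) \<boxplus>\<^bsub>C\<^esub>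
     ((inj2 S' \<cdot>\<^bsub>C\<^esub> c \<cdot>\<^bsub>C\<^esub> proj1 S) \<boxplus>\<^bsub>C\<^esub> (inj2 S' \<cdot>\<^bsub>C\<^esub> d \<cdot>\<^bsub>C\<^esub> proj2 S))"


section \<open>Triangulated categories\<close>

text \<open>\<open>Triangle X Y Z u v w\<close> stands for a sequence \<open>X \<rightarrow> Y \<rightarrow> Z \<rightarrow> \<Sigma>X\<close> with maps \<open>u, v, w\<close>.\<close>

datatype ('o, 'm) triangle =
  Triangle (ob1: 'o) (ob2: 'o) (ob3: 'o) (map1: 'm) (map2: 'm) (map3: 'm)

record ('o, 'm) tri_cat = "('o, 'm) preadd_cat" +
  susp_obj :: "'o \<Rightarrow> 'o"
  susp_map :: "'m \<Rightarrow> 'm"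
  Exact :: "('o, 'm) triangle set"

fun is_sequence :: "('o, 'm, 'x) tri_cat_scheme \<Rightarrow> ('o, 'm) triangle \<Rightarrow> bool" where
  "is_sequence T (Triangle X Y Z u v w) \<longleftrightarrow>
     u \<in> Hom T X Y \<and> v \<in> Hom T Y Z \<and> w \<in> Hom T Z (susp_obj T X)"

fun triangle_map ::
  "('o, 'm, 'x) tri_cat_scheme \<Rightarrow> ('o, 'm) triangle \<Rightarrow> ('o, 'm) triangle
     \<Rightarrow> 'm \<Rightarrow> 'm \<Rightarrow> 'm \<Rightarrow> bool"
where
  "triangle_map T (Triangle X Y Z u v w) (Triangle X' Y' Z' u' v' w') f g h \<longleftrightarrow>
     f \<in> Hom T X X' \<and> g \<in> Hom T Y Y' \<and> h \<in> Hom T Z Z' \<and>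
     g \<cdot>\<^bsub>T\<^esub> u = u' \<cdot>\<^bsub>T\<^esub> f \<and>
     h \<cdot>\<^bsub>T\<^esub> v = v' \<cdot>\<^bsub>T\<^esub> g \<and>
     susp_map T f \<cdot>\<^bsub>T\<^esub> w = w' \<cdot>\<^bsub>T\<^esub> h"

text \<open>
  \<open>octahedron T Da Db Dc Dd\<close>: here \<open>Da, Db, Dc\<close> are the triangles on \<open>a\<close>, \<open>b\<close> and
  \<open>c = b a\<close>, and \<open>Dd\<close> is the triangle formed by \<open>\<alpha>, \<beta>, \<gamma>\<close> on the three cofibres.
\<close>

fun octahedron ::
  "('o, 'm, 'x) tri_cat_scheme \<Rightarrow> ('o, 'm) triangle \<Rightarrow> ('o, 'm) triangle
     \<Rightarrow> ('o, 'm) triangle \<Rightarrow> ('o, 'm) triangle \<Rightarrow> bool"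
where
  "octahedron T (Triangle P Q Ca a a' a'') (Triangle Q1 R Cb b b' b'')
       (Triangle P1 R1 Cc c c' c'') (Triangle Ca1 Cc1 Cb1 \<alpha> \<beta> \<gamma>) \<longleftrightarrow>
     Q1 = Q \<and> P1 = P \<and> R1 = R \<and> Ca1 = Ca \<and> Cc1 = Cc \<and> Cb1 = Cb \<and>
     c = b \<cdot>\<^bsub>T\<^esub> a \<and>
     Triangle P Q Ca a a' a'' \<in> Exact T \<and>
     Triangle Q R Cb b b' b'' \<in> Exact T \<and>
     Triangle P R Cc c c' c'' \<in> Exact T \<and>
     Triangle Ca Cc Cb \<alpha> \<beta> \<gamma> \<in> Exact T \<and>
     \<alpha> \<cdot>\<^bsub>T\<^esub> a' = c' \<cdot>\<^bsub>T\<^esub> b \<and>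
     c'' \<cdot>\<^bsub>T\<^esub> \<alpha> = a'' \<and>
     \<beta> \<cdot>\<^bsub>T\<^esub> c' = b' \<and>
     \<gamma> = susp_map T a' \<cdot>\<^bsub>T\<^esub> b'' \<and>
     b'' \<cdot>\<^bsub>T\<^esub> \<beta> = susp_map T a \<cdot>\<^bsub>T\<^esub> c''"

locale triangulated_category = additive_category T
  for T :: "('o, 'm, 'x) tri_cat_scheme" (structure) +
  assumes susp_equivalence: "equivalence_functor T T (susp_obj T) (susp_map T)"
    and susp_additive: "f \<in> Hom T X Y \<Longrightarrow> f' \<in> Hom T X Y
      \<Longrightarrow> susp_map T (f \<boxplus> f') = susp_map T f \<boxplus> susp_map T f'"
    and Exact_sequence: "D \<in> Exact T \<Longrightarrow> is_sequence T D"
    and Exact_iso: "D \<in> Exact T \<Longrightarrow> is_sequence T D' \<Longrightarrow> triangle_map T D D' f g h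
      \<Longrightarrow> is_iso T f \<Longrightarrow> is_iso T g \<Longrightarrow> is_iso T h \<Longrightarrow> D' \<in> Exact T"
    and Exact_Id: "X \<in> Obj T \<Longrightarrow> zero_object T Z
      \<Longrightarrow> Triangle X X Z (Id T X) (Zero T X Z) (Zero T Z (susp_obj T X)) \<in> Exact T"
    and ex_cofibre: "u \<in> Hom T X Y \<Longrightarrow> \<exists>Z v w. Triangle X Y Z u v w \<in> Exact T"
    and rotation: "is_sequence T (Triangle X Y Z u v w)
      \<Longrightarrow> Triangle X Y Z u v w \<in> Exact T
            \<longleftrightarrow> Triangle Y Z (susp_obj T X) v w (Neg T (susp_map T u)) \<in> Exact T"
    and fill_in: "Triangle X Y Z u v w \<in> Exact T \<Longrightarrow> Triangle X' Y' Z' u' v' w' \<in> Exact T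
      \<Longrightarrow> f \<in> Hom T X X' \<Longrightarrow> g \<in> Hom T Y Y' \<Longrightarrow> g \<cdot> u = u' \<cdot> f
      \<Longrightarrow> \<exists>h. triangle_map T (Triangle X Y Z u v w) (Triangle X' Y' Z' u' v' w') f g h"
    and octahedral: "Triangle P Q Ca a a' a'' \<in> Exact T \<Longrightarrow> Triangle Q R Cb b b' b'' \<in> Exact T
      \<Longrightarrow> Triangle P R Cc (b \<cdot> a) c' c'' \<in> Exact T
      \<Longrightarrow> \<exists>\<alpha> \<beta> \<gamma>. octahedron T (Triangle P Q Ca a a' a'') (Triangle Q R Cb b b' b'')
            (Triangle P R Cc (b \<cdot> a) c' c'') (Triangle Ca Cc Cb \<alpha> \<beta> \<gamma>)"


section \<open>Good and Verdier good maps of triangles\<close>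

fun susp_biprod :: "('o, 'm, 'x) tri_cat_scheme \<Rightarrow> ('o, 'm) biprod \<Rightarrow> ('o, 'm) biprod" where
  "susp_biprod T (Biprod S i j p q) =
     Biprod (susp_obj T S) (susp_map T i) (susp_map T j) (susp_map T p) (susp_map T q)"

text \<open>
  \<open>S1, S2, S3\<close> are to be direct sums \<open>X' \<oplus> Y\<close>, \<open>Y' \<oplus> Z\<close> and \<open>Z' \<oplus> \<Sigma>X\<close>.  The last object
  \<open>\<Sigma>X' \<oplus> \<Sigma>Y\<close> of the cone is \<open>\<Sigma>(X' \<oplus> Y)\<close>, with the suspended injections and projections.
\<close>

fun mapping_cone ::
  "('o, 'm, 'x) tri_cat_scheme \<Rightarrow> ('o, 'm) biprod \<Rightarrow> ('o, 'm) biprod \<Rightarrow> ('o, 'm) biprod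
     \<Rightarrow> ('o, 'm) triangle \<Rightarrow> ('o, 'm) triangle \<Rightarrow> 'm \<Rightarrow> 'm \<Rightarrow> 'm \<Rightarrow> ('o, 'm) triangle"
where
  "mapping_cone T S1 S2 S3 (Triangle X Y Z u v w) (Triangle X' Y' Z' u' v' w') f g h =
     Triangle (sum_obj S1) (sum_obj S2) (sum_obj S3)
       (matrix_map T S1 S2
          u'            g
          (Zero T X' Z) (Neg T v))
       (matrix_map T S2 S3
          v'                           h
          (Zero T Y' (susp_obj T X)) (Neg T w))
       (matrix_map T S3 (susp_biprod T S1)
          w'                           (susp_map T f)
          (Zero T Z' (susp_obj T Y)) (Neg T (susp_map T u)))"

text \<open>
  The choice of the direct sums is immaterial: different choices give isomorphic cones.
\<close>

fun good ::
  "('o, 'm, 'x) tri_cat_scheme \<Rightarrow> ('o, 'm) triangle \<Rightarrow> ('o, 'm) triangle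
     \<Rightarrow> 'm \<Rightarrow> 'm \<Rightarrow> 'm \<Rightarrow> bool"
where
  "good T (Triangle X Y Z u v w) (Triangle X' Y' Z' u' v' w') f g h \<longleftrightarrow>
     (\<exists>S1 S2 S3. is_biproduct T X' Y S1 \<and> is_biproduct T Y' Z S2 \<and>
        is_biproduct T Z' (susp_obj T X) S3 \<and>
        mapping_cone T S1 S2 S3
          (Triangle X Y Z u v w) (Triangle X' Y' Z' u' v' w') f g h \<in> Exact T)"

text \<open>
  The notion of a Verdier good map does not depend on the chosen triangles on \<open>f\<close>, \<open>g\<close> and
  \<open>g u\<close>; it is stated here for every choice.
\<close>

fun verdier_good ::
  "('o, 'm, 'x) tri_cat_scheme \<Rightarrow> ('o, 'm) triangle \<Rightarrow> ('o, 'm) triangle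
     \<Rightarrow> 'm \<Rightarrow> 'm \<Rightarrow> 'm \<Rightarrow> bool"
where
  "verdier_good T (Triangle X Y Z u v w) (Triangle X' Y' Z' u' v' w') f g h \<longleftrightarrow>
     (\<forall>X'' f' f'' Y'' g' g'' A vt wt.
        Triangle X X' X'' f f' f'' \<in> Exact T \<longrightarrow>
        Triangle Y Y' Y'' g g' g'' \<in> Exact T \<longrightarrow>
        Triangle X Y' A (g \<cdot>\<^bsub>T\<^esub> u) vt wt \<in> Exact T \<longrightarrow>
        (\<exists>\<alpha>\<^sub>1 \<beta>\<^sub>1 \<gamma>\<^sub>1 \<alpha>\<^sub>2 \<beta>\<^sub>2 \<gamma>\<^sub>2.
           octahedron T (Triangle X Y Z u v w) (Triangle Y Y' Y'' g g' g'')
             (Triangle X Y' A (g \<cdot>\<^bsub>T\<^esub> u) vt wt) (Triangle Z A Y'' \<alpha>\<^sub>1 \<beta>\<^sub>1 \<gamma>\<^sub>1) \<and>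
           octahedron T (Triangle X X' X'' f f' f'') (Triangle X' Y' Z' u' v' w')
             (Triangle X Y' A (g \<cdot>\<^bsub>T\<^esub> u) vt wt) (Triangle X'' A Z' \<alpha>\<^sub>2 \<beta>\<^sub>2 \<gamma>\<^sub>2) \<and>
           h = \<beta>\<^sub>2 \<cdot>\<^bsub>T\<^esub> \<alpha>\<^sub>1))"


section \<open>Weakly functorial octahedra\<close>

datatype ('o, 'm) octa =
  Octa (tri_a: "('o, 'm) triangle") (tri_b: "('o, 'm) triangle")
       (tri_c: "('o, 'm) triangle") (tri_cof: "('o, 'm) triangle")

definition octahedron_based_on ::
  "('o, 'm, 'x) tri_cat_scheme \<Rightarrow> 'o \<Rightarrow> 'o \<Rightarrow> 'o \<Rightarrow> 'm \<Rightarrow> 'm \<Rightarrow> ('o, 'm) octa \<Rightarrow> bool"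
where
  "octahedron_based_on T P Q R a b K \<longleftrightarrow>
     octahedron T (tri_a K) (tri_b K) (tri_c K) (tri_cof K) \<and>
     ob1 (tri_a K) = P \<and> ob2 (tri_a K) = Q \<and> map1 (tri_a K) = a \<and>
     ob1 (tri_b K) = Q \<and> ob2 (tri_b K) = R \<and> map1 (tri_b K) = b"

text \<open>
  Components: \<open>\<phi>\<^sub>1, \<phi>\<^sub>2, \<phi>\<^sub>3\<close> on the base objects and \<open>\<psi>a, \<psi>b, \<psi>c\<close> on the cofibres of
  \<open>a\<close>, \<open>b\<close>, \<open>b a\<close>.  Every structure map of an octahedron occurs in one of its four triangles.
\<close>

definition octahedron_map ::
  "('o, 'm, 'x) tri_cat_scheme \<Rightarrow> ('o, 'm) octa \<Rightarrow> ('o, 'm) octa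
     \<Rightarrow> 'm \<Rightarrow> 'm \<Rightarrow> 'm \<Rightarrow> 'm \<Rightarrow> 'm \<Rightarrow> 'm \<Rightarrow> bool"
where
  "octahedron_map T K L \<phi>\<^sub>1 \<phi>\<^sub>2 \<phi>\<^sub>3 \<psi>a \<psi>b \<psi>c \<longleftrightarrow>
     triangle_map T (tri_a K) (tri_a L) \<phi>\<^sub>1 \<phi>\<^sub>2 \<psi>a \<and>
     triangle_map T (tri_b K) (tri_b L) \<phi>\<^sub>2 \<phi>\<^sub>3 \<psi>b \<and>
     triangle_map T (tri_c K) (tri_c L) \<phi>\<^sub>1 \<phi>\<^sub>3 \<psi>c \<and>
     triangle_map T (tri_cof K) (tri_cof L) \<psi>a \<psi>c \<psi>b"

definition weakly_functorial_octahedra :: "('o, 'm, 'x) tri_cat_scheme \<Rightarrow> bool" where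
  "weakly_functorial_octahedra T \<longleftrightarrow>
     (\<forall>X\<^sub>1 X\<^sub>2 X\<^sub>3 Y\<^sub>1 Y\<^sub>2 Y\<^sub>3. \<forall>f\<^sub>1 \<in> Hom T X\<^sub>1 X\<^sub>2. \<forall>f\<^sub>2 \<in> Hom T X\<^sub>2 X\<^sub>3.
      \<forall>g\<^sub>1 \<in> Hom T Y\<^sub>1 Y\<^sub>2. \<forall>g\<^sub>2 \<in> Hom T Y\<^sub>2 Y\<^sub>3.
      \<forall>\<phi>\<^sub>1 \<in> Hom T X\<^sub>1 Y\<^sub>1. \<forall>\<phi>\<^sub>2 \<in> Hom T X\<^sub>2 Y\<^sub>2. \<forall>\<phi>\<^sub>3 \<in> Hom T X\<^sub>3 Y\<^sub>3.
        \<phi>\<^sub>2 \<cdot>\<^bsub>T\<^esub> f\<^sub>1 = g\<^sub>1 \<cdot>\<^bsub>T\<^esub> \<phi>\<^sub>1 \<longrightarrow> \<phi>\<^sub>3 \<cdot>\<^bsub>T\<^esub> f\<^sub>2 = g\<^sub>2 \<cdot>\<^bsub>T\<^esub> \<phi>\<^sub>2 \<longrightarrow>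
        (\<exists>K L \<psi>a \<psi>b \<psi>c.
           octahedron_based_on T X\<^sub>1 X\<^sub>2 X\<^sub>3 f\<^sub>1 f\<^sub>2 K \<and>
           octahedron_based_on T Y\<^sub>1 Y\<^sub>2 Y\<^sub>3 g\<^sub>1 g\<^sub>2 L \<and>
           octahedron_map T K L \<phi>\<^sub>1 \<phi>\<^sub>2 \<phi>\<^sub>3 \<psi>a \<psi>b \<psi>c))"

end

(*
  If (f, g, 0) is good, the projection from its mapping cone to the target triangle yields a lift
  theta : Y -> X' with f = theta u and g = u' theta. A weakly functorial octahedron for the map
  (id, theta, id) from X -> Y -> Y' to X -> X' -> Y' then compares the two octahedra on g u = u' f,
  and in the comparison beta2 alpha1 factors through beta2 alpha2 = 0.
*)

theory Submission
  imports Defs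
begin

text \<open>The lift cannot be read off the projection directly: completing a map of triangles gives
  some third component, with no control over which. After one rotation it is a map \<open>H\<close>
  from the suspension of X' (+) Y to that of X'. Its first entry need not be the identity, but it is
  compatible with the neighbouring maps of the target triangle and hence invertible, and dividing by
  it corrects the second entry. All this happens between suspended objects, so fullness and
  faithfulness of the suspension are needed to return to a map Y -> X'. The second obstacle is
  choice. Weak functoriality supplies octahedra on cofibres of its own choosing, whereas
  \<open>verdier_good\<close> speaks of every choice of triangles on f, g and gu, with Z and Z'
  already fixed. So octahedra are moved along isomorphisms of cofibres, and these must be
  coordinated: both octahedra have to end on the same cofibre of gu. Fill-ins are not unique, but a
  fill-in of identities between two triangles on the same map is invertible, which suffices.\<close>

lemma Hom_iff: "f \<in> Hom C X Y \<longleftrightarrow> f \<in> Arr C \<and> Dom C f = X \<and> Cod C f = Y"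
  by (auto simp: Hom_def)

section \<open>Categories: typed composition and isomorphisms\<close>

context category
begin

lemma Hom_Obj: "f \<in> Hom C X Y \<Longrightarrow> X \<in> Obj C" "f \<in> Hom C X Y \<Longrightarrow> Y \<in> Obj C"
  using Dom_in_Obj Cod_in_Obj by (auto simp: Hom_def)

text \<open>The category axioms quantify over objects that do not occur in the composites
  themselves. Reading these objects off \<open>Dom\<close> and \<open>Cod\<close> turns the axioms
  into rewrite rules.\<close>

lemma Arr_Comp:
  assumes "f \<in> Arr C" "g \<in> Arr C" "Cod C f = Dom C g"
  shows "g \<cdot> f \<in> Arr C" "Dom C (g \<cdot> f) = Dom C f" "Cod C (g \<cdot> f) = Cod C g"
  using Comp_in_Hom[of f "Dom C f" "Cod C f" g "Cod C g"] assms by (auto simp: Hom_def)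

lemma Arr_Comp_assoc:
  assumes "f \<in> Arr C" "g \<in> Arr C" "h \<in> Arr C" "Cod C f = Dom C g" "Cod C g = Dom C h"
  shows "(h \<cdot> g) \<cdot> f = h \<cdot> (g \<cdot> f)"
  using Comp_assoc[of f "Dom C f" "Cod C f" g "Cod C g" h "Cod C h"] assms
  by (auto simp: Hom_def)

lemma Arr_Id:
  assumes "X \<in> Obj C"
  shows "Id C X \<in> Arr C" "Dom C (Id C X) = X" "Cod C (Id C X) = X"
  using Id_in_Hom[OF assms] by (auto simp: Hom_def)

lemma Arr_Comp_Id:
  assumes "f \<in> Arr C"
  shows "Cod C f = Y \<Longrightarrow> Id C Y \<cdot> f = f" "Dom C f = X \<Longrightarrow> f \<cdot> Id C X = f"
  using assms Id_left[of f "Dom C f" Y] Id_right[of f X "Cod C f"] by (auto simp: Hom_def)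

lemmas Arr_simps = Arr_Comp Arr_Comp_assoc Arr_Id Arr_Comp_Id Dom_in_Obj Cod_in_Obj

lemma is_isoI:
  assumes "f \<in> Hom C X Y" "g \<in> Hom C Y X" "g \<cdot> f = Id C X" "f \<cdot> g = Id C Y"
  shows "is_iso C f"
  using assms by (auto simp: is_iso_def Hom_def)

lemma is_isoE:
  assumes "is_iso C f" "f \<in> Hom C X Y"
  obtains g where "g \<in> Hom C Y X" "g \<cdot> f = Id C X" "f \<cdot> g = Id C Y"
  using assms by (auto simp: is_iso_def Hom_def)

lemma is_iso_cancel_left:
  assumes "is_iso C h" "h \<in> Hom C Y Z" "f \<in> Hom C X Y" "g \<in> Hom C X Y" "h \<cdot> f = h \<cdot> g"
  shows "f = g"
proof -
  obtain k where k: "k \<in> Hom C Z Y" "k \<cdot> h = Id C Y"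
    using is_isoE[OF assms(1,2)] by metis
  have "(k \<cdot> h) \<cdot> f = (k \<cdot> h) \<cdot> g"
    using Comp_assoc[OF assms(3,2) k(1)] Comp_assoc[OF assms(4,2) k(1)] assms(5) by simp
  then show ?thesis
    unfolding k(2) using Id_left[OF assms(3)] Id_left[OF assms(4)] by simp
qed

lemma is_iso_cancel_right:
  assumes "is_iso C h" "h \<in> Hom C X Y" "f \<in> Hom C Y Z" "g \<in> Hom C Y Z" "f \<cdot> h = g \<cdot> h"
  shows "f = g"
proof -
  obtain k where k: "k \<in> Hom C Y X" "h \<cdot> k = Id C Y"
    using is_isoE[OF assms(1,2)] by metis
  have "f \<cdot> (h \<cdot> k) = g \<cdot> (h \<cdot> k)"
    using Comp_assoc[OF k(1) assms(2,3)] Comp_assoc[OF k(1) assms(2,4)] assms(5) by simp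
  then show ?thesis
    unfolding k(2) using Id_right[OF assms(3)] Id_right[OF assms(4)] by simp
qed

text \<open>Inverting the two composites yields a left inverse and a right inverse of
  \<open>f\<close>, and these agree by associativity.\<close>

lemma is_iso_left_right_inverse:
  assumes "f \<in> Hom C X Y" "g \<in> Hom C Y X" "h \<in> Hom C Y X"
    and "is_iso C (g \<cdot> f)" "is_iso C (f \<cdot> h)"
  shows "is_iso C f"
proof -
  have gf: "g \<cdot> f \<in> Hom C X X" and fh: "f \<cdot> h \<in> Hom C Y Y"
    using assms Comp_in_Hom by blast+
  obtain k where k: "k \<in> Hom C X X" "k \<cdot> (g \<cdot> f) = Id C X"
    using is_isoE[OF assms(4) gf] by metis
  obtain l where l: "l \<in> Hom C Y Y" "(f \<cdot> h) \<cdot> l = Id C Y"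
    using is_isoE[OF assms(5) fh] by metis
  have L: "(k \<cdot> g) \<cdot> f = Id C X"
    using k assms by (simp add: Hom_iff Arr_simps)
  have R: "f \<cdot> (h \<cdot> l) = Id C Y"
    using l assms by (simp add: Hom_iff Arr_simps)
  have kg: "k \<cdot> g \<in> Hom C Y X" and hl: "h \<cdot> l \<in> Hom C Y X"
    using assms k l Comp_in_Hom by blast+
  have "k \<cdot> g = h \<cdot> l"
    using Comp_assoc[OF hl assms(1) kg] Id_right[OF kg] Id_left[OF hl] unfolding L R by simp
  with L R show ?thesis
    using is_isoI[OF assms(1) hl] by simp
qed

end

section \<open>Functors: an equivalence is full and faithful\<close>

lemma functor_Hom:
  "is_functor C D Fo Fm \<Longrightarrow> f \<in> Hom C X Y \<Longrightarrow> Fm f \<in> Hom D (Fo X) (Fo Y)"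
  by (auto simp: is_functor_def)

lemma functor_Comp:
  "is_functor C D Fo Fm \<Longrightarrow> f \<in> Hom C X Y \<Longrightarrow> g \<in> Hom C Y Z
    \<Longrightarrow> Fm (g \<cdot>\<^bsub>C\<^esub> f) = Fm g \<cdot>\<^bsub>D\<^esub> Fm f"
  unfolding is_functor_def by blast

lemma functor_Id:
  "is_functor C D Fo Fm \<Longrightarrow> X \<in> Obj C \<Longrightarrow> Fm (Id C X) = Id D (Fo X)"
  by (auto simp: is_functor_def)

lemma natural_iso_component:
  assumes "natural_iso C D Fo Fm Go Gm \<eta>" "X \<in> Obj C"
  shows "\<eta> X \<in> Hom D (Fo X) (Go X)" "is_iso D (\<eta> X)"
  using assms by (auto simp: natural_iso_def)

lemma natural_iso_square:
  "natural_iso C D Fo Fm Go Gm \<eta> \<Longrightarrow> f \<in> Hom C X Y \<Longrightarrow> \<eta> Y \<cdot>\<^bsub>D\<^esub> Fm f = Gm f \<cdot>\<^bsub>D\<^esub> \<eta> X"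
  by (auto simp: natural_iso_def)

text \<open>Naturality of the unit shows that \<open>\<eta> Y \<cdot> f\<close> depends on
  \<open>f\<close> only through \<open>Fm f\<close>.\<close>

lemma equivalence_functor_faithful:
  assumes "category C" "category D" "equivalence_functor C D Fo Fm"
    and "f \<in> Hom C X Y" "g \<in> Hom C X Y" "Fm f = Fm g"
  shows "f = g"
proof -
  interpret C: category C by fact
  obtain Go Gm \<eta> where \<eta>: "natural_iso C C id id (Go \<circ> Fo) (Gm \<circ> Fm) \<eta>"
    using assms(3) by (auto simp: equivalence_functor_def)
  have "\<eta> Y \<cdot>\<^bsub>C\<^esub> f = \<eta> Y \<cdot>\<^bsub>C\<^esub> g"
    using natural_iso_square[OF \<eta> assms(4)] natural_iso_square[OF \<eta> assms(5)] assms(6) by simp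
  moreover have "Y \<in> Obj C" using C.Hom_Obj assms(4) by blast
  ultimately show ?thesis
    using C.is_iso_cancel_left[OF _ _ assms(4,5)] natural_iso_component[OF \<eta>, of Y] by auto
qed

text \<open>The preimage of \<open>h\<close> is \<open>Gm h\<close> conjugated by the unit. This
  gives equality only after applying \<open>Gm\<close>; since \<open>equivalence_functor\<close>
  ties unit and counit by no triangle identity, the counit is then used separately to cancel
  \<open>Gm\<close>.\<close>

lemma equivalence_functor_full:
  assumes "category C" "category D" "equivalence_functor C D Fo Fm"
    and "X \<in> Obj C" "Y \<in> Obj C" "h \<in> Hom D (Fo X) (Fo Y)"
  obtains f where "f \<in> Hom C X Y" "Fm f = h"
proof -
  interpret C: category C by fact
  interpret D: category D by fact
  obtain Go Gm \<eta> \<epsilon> where \<eta>: "natural_iso C C id id (Go \<circ> Fo) (Gm \<circ> Fm) \<eta>"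
    and \<epsilon>: "natural_iso D D (Fo \<circ> Go) (Fm \<circ> Gm) id id \<epsilon>"
    and F: "is_functor C D Fo Fm" and G: "is_functor D C Go Gm"
    using assms(3) by (auto simp: equivalence_functor_def)
  have \<eta>X: "\<eta> X \<in> Hom C X (Go (Fo X))" "is_iso C (\<eta> X)"
    and \<eta>Y: "\<eta> Y \<in> Hom C Y (Go (Fo Y))" "is_iso C (\<eta> Y)"
    using natural_iso_component[OF \<eta>] assms(4,5) by auto
  obtain \<theta> where \<theta>: "\<theta> \<in> Hom C (Go (Fo Y)) Y" "\<eta> Y \<cdot>\<^bsub>C\<^esub> \<theta> = Id C (Go (Fo Y))"
    using C.is_isoE[OF \<eta>Y(2,1)] by metis
  have Gh: "Gm h \<in> Hom C (Go (Fo X)) (Go (Fo Y))"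
    using functor_Hom[OF G assms(6)] .
  define f where "f = \<theta> \<cdot>\<^bsub>C\<^esub> (Gm h \<cdot>\<^bsub>C\<^esub> \<eta> X)"
  have f: "f \<in> Hom C X Y"
    unfolding f_def using \<theta> Gh \<eta>X by (blast intro: C.Comp_in_Hom)
  have Ff: "Fm f \<in> Hom D (Fo X) (Fo Y)" using functor_Hom[OF F f] .
  have "Gm (Fm f) \<cdot>\<^bsub>C\<^esub> \<eta> X = \<eta> Y \<cdot>\<^bsub>C\<^esub> f"
    using natural_iso_square[OF \<eta> f] by simp
  also have "\<dots> = (\<eta> Y \<cdot>\<^bsub>C\<^esub> \<theta>) \<cdot>\<^bsub>C\<^esub> (Gm h \<cdot>\<^bsub>C\<^esub> \<eta> X)"
    unfolding f_def using \<eta>Y \<theta>(1) Gh \<eta>X by (simp add: Hom_iff C.Arr_simps)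
  also have "\<dots> = Gm h \<cdot>\<^bsub>C\<^esub> \<eta> X"
    unfolding \<theta>(2) using Gh \<eta>X by (simp add: Hom_iff C.Arr_simps)
  finally have "Gm (Fm f) = Gm h"
    using C.is_iso_cancel_right[OF \<eta>X(2,1) functor_Hom[OF G Ff] Gh] by simp
  then have "Fm f \<cdot>\<^bsub>D\<^esub> \<epsilon> (Fo X) = h \<cdot>\<^bsub>D\<^esub> \<epsilon> (Fo X)"
    using natural_iso_square[OF \<epsilon> Ff] natural_iso_square[OF \<epsilon> assms(6)] by simp
  moreover have "\<epsilon> (Fo X) \<in> Hom D (Fo (Go (Fo X))) (Fo X)" "is_iso D (\<epsilon> (Fo X))"
    using natural_iso_component[OF \<epsilon>, of "Fo X"] D.Hom_Obj(1)[OF Ff] by auto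
  ultimately have "Fm f = h"
    using D.is_iso_cancel_right Ff assms(6) by metis
  with f show thesis by (rule that)
qed

section \<open>Additive categories: arithmetic of maps\<close>

context additive_category
begin

lemma Zero_in_Hom: "X \<in> Obj C \<Longrightarrow> Y \<in> Obj C \<Longrightarrow> Zero C X Y \<in> Hom C X Y"
  using monoid.one_closed[of "hom_group C X Y"] hom_comm_group[of X Y]
  by (auto simp: hom_group_def comm_group_def group_def)

lemma Add_in_Hom: "f \<in> Hom C X Y \<Longrightarrow> g \<in> Hom C X Y \<Longrightarrow> f \<boxplus> g \<in> Hom C X Y"
  using monoid.m_closed[of "hom_group C X Y" f g] hom_comm_group[of X Y] Hom_Obj[of f X Y]
  by (auto simp: hom_group_def comm_group_def group_def)

lemma Add_assoc:
  "f \<in> Hom C X Y \<Longrightarrow> g \<in> Hom C X Y \<Longrightarrow> h \<in> Hom C X Y \<Longrightarrow> (f \<boxplus> g) \<boxplus> h = f \<boxplus> (g \<boxplus> h)"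
  using monoid.m_assoc[of "hom_group C X Y" f g h] hom_comm_group[of X Y] Hom_Obj[of f X Y]
  by (auto simp: hom_group_def comm_group_def group_def)

lemma Add_commute: "f \<in> Hom C X Y \<Longrightarrow> g \<in> Hom C X Y \<Longrightarrow> f \<boxplus> g = g \<boxplus> f"
  using comm_monoid.m_comm[of "hom_group C X Y" f g] hom_comm_group[of X Y] Hom_Obj[of f X Y]
  by (auto simp: hom_group_def comm_group_def)

lemma Add_Zero_right: "f \<in> Hom C X Y \<Longrightarrow> f \<boxplus> Zero C X Y = f"
  using monoid.r_one[of "hom_group C X Y" f] hom_comm_group[of X Y] Hom_Obj[of f X Y]
  by (auto simp: hom_group_def comm_group_def group_def)

lemma Add_Zero_left: "f \<in> Hom C X Y \<Longrightarrow> Zero C X Y \<boxplus> f = f"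
  using monoid.l_one[of "hom_group C X Y" f] hom_comm_group[of X Y] Hom_Obj[of f X Y]
  by (auto simp: hom_group_def comm_group_def group_def)

lemma Neg_in_Hom: "f \<in> Hom C X Y \<Longrightarrow> Neg C f \<in> Hom C X Y"
  using group.inv_closed[of "hom_group C X Y" f] hom_comm_group[of X Y] Hom_Obj[of f X Y]
  unfolding Neg_def by (auto simp: hom_group_def comm_group_def Hom_iff)

lemma Add_Neg: "f \<in> Hom C X Y \<Longrightarrow> f \<boxplus> Neg C f = Zero C X Y"
  using group.r_inv[of "hom_group C X Y" f] hom_comm_group[of X Y] Hom_Obj[of f X Y]
  unfolding Neg_def by (auto simp: hom_group_def comm_group_def Hom_iff)

lemma Add_left_cancel:
  assumes "f \<in> Hom C X Y" "g \<in> Hom C X Y" "h \<in> Hom C X Y" "f \<boxplus> g = f \<boxplus> h"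
  shows "g = h"
proof -
  note m = Neg_in_Hom[OF assms(1)]
  have "Neg C f \<boxplus> f = Zero C X Y"
    using Add_commute[OF m assms(1)] Add_Neg[OF assms(1)] by simp
  then show ?thesis
    using Add_assoc[OF m assms(1,2)] Add_assoc[OF m assms(1,3)] assms(4)
      Add_Zero_left[OF assms(2)] Add_Zero_left[OF assms(3)] by simp
qed

lemma Neg_unique:
  assumes "f \<in> Hom C X Y" "g \<in> Hom C X Y" "f \<boxplus> g = Zero C X Y"
  shows "Neg C f = g"
  using Add_left_cancel[OF assms(1) Neg_in_Hom[OF assms(1)] assms(2)] Add_Neg[OF assms(1)] assms(3)
  by simp

lemma Neg_inject:
  assumes "f \<in> Hom C X Y" "g \<in> Hom C X Y" "Neg C f = Neg C g"
  shows "f = g"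
  using Add_left_cancel[OF Neg_in_Hom[OF assms(1)] assms(1,2)]
    Add_commute[OF assms(1) Neg_in_Hom[OF assms(1)]]
    Add_commute[OF assms(2) Neg_in_Hom[OF assms(2)]]
    Add_Neg[OF assms(1)] Add_Neg[OF assms(2)] assms(3)
  by simp

lemma idempotent_Add_Zero:
  assumes "f \<in> Hom C X Y" "f \<boxplus> f = f"
  shows "f = Zero C X Y"
  using Add_left_cancel[OF assms(1,1) Zero_in_Hom[OF Hom_Obj[OF assms(1)]]]
    Add_Zero_right[OF assms(1)] assms(2)
  by simp

lemma Comp_Zero_right:
  assumes "X \<in> Obj C" "g \<in> Hom C Y Z"
  shows "g \<cdot> Zero C X Y = Zero C X Z"
proof -
  have z: "Zero C X Y \<in> Hom C X Y" using Zero_in_Hom assms Hom_Obj by blast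
  have "g \<cdot> (Zero C X Y \<boxplus> Zero C X Y) = (g \<cdot> Zero C X Y) \<boxplus> (g \<cdot> Zero C X Y)"
    by (rule Comp_Add_right[OF z z assms(2)])
  then show ?thesis
    using idempotent_Add_Zero Add_Zero_left[OF z] Comp_in_Hom[OF z assms(2)] by simp
qed

lemma Comp_Zero_left:
  assumes "f \<in> Hom C X Y" "Z \<in> Obj C"
  shows "Zero C Y Z \<cdot> f = Zero C X Z"
proof -
  have z: "Zero C Y Z \<in> Hom C Y Z" using Zero_in_Hom assms Hom_Obj by blast
  have "(Zero C Y Z \<boxplus> Zero C Y Z) \<cdot> f = (Zero C Y Z \<cdot> f) \<boxplus> (Zero C Y Z \<cdot> f)"
    by (rule Comp_Add_left[OF assms(1) z z])
  then show ?thesis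
    using idempotent_Add_Zero Add_Zero_left[OF z] Comp_in_Hom[OF assms(1) z] by simp
qed

lemma Comp_Neg_right:
  assumes "f \<in> Hom C X Y" "g \<in> Hom C Y Z"
  shows "g \<cdot> Neg C f = Neg C (g \<cdot> f)"
proof -
  note m = Neg_in_Hom[OF assms(1)]
  have "(g \<cdot> f) \<boxplus> (g \<cdot> Neg C f) = Zero C X Z"
    using Comp_Add_right[OF assms(1) m assms(2)] Add_Neg[OF assms(1)]
      Comp_Zero_right[OF Hom_Obj(1)[OF assms(1)] assms(2)] by simp
  then show ?thesis
    using Neg_unique[OF Comp_in_Hom[OF assms] Comp_in_Hom[OF m assms(2)]] by simp
qed

lemma Comp_Neg_left:
  assumes "f \<in> Hom C X Y" "g \<in> Hom C Y Z"
  shows "Neg C g \<cdot> f = Neg C (g \<cdot> f)"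
proof -
  note m = Neg_in_Hom[OF assms(2)]
  have "(g \<cdot> f) \<boxplus> (Neg C g \<cdot> f) = Zero C X Z"
    using Comp_Add_left[OF assms m] Add_Neg[OF assms(2)]
      Comp_Zero_left[OF assms(1) Hom_Obj(2)[OF assms(2)]] by simp
  then show ?thesis
    using Neg_unique[OF Comp_in_Hom[OF assms] Comp_in_Hom[OF assms(1) m]] by simp
qed

lemma Neg_Zero: "X \<in> Obj C \<Longrightarrow> Y \<in> Obj C \<Longrightarrow> Neg C (Zero C X Y) = Zero C X Y"
  using Neg_unique[OF Zero_in_Hom Zero_in_Hom] Add_Zero_left[OF Zero_in_Hom] by blast

lemma zero_object_Hom_to: "zero_object C Z \<Longrightarrow> f \<in> Hom C X Z \<Longrightarrow> f = Zero C X Z"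
  unfolding zero_object_def by (metis Hom_Obj(1) Zero_in_Hom)

lemma zero_objectI:
  assumes "Z \<in> Obj C" "Id C Z = Zero C Z Z"
  shows "zero_object C Z"
proof -
  have "f = Zero C X Z" if "f \<in> Hom C X Z" for f X
    using Id_left[OF that] Comp_Zero_left[OF that assms(1)] assms(2) by simp
  moreover have "f = Zero C Z X" if "f \<in> Hom C Z X" for f X
    using Id_right[OF that] Comp_Zero_right[OF assms(1) that] assms(2) by simp
  ultimately show ?thesis
    unfolding zero_object_def using assms(1) Zero_in_Hom by metis
qed

text \<open>The inverse is id - n, because (id - n)(id + n) = id - n n in either order.\<close>

lemma is_iso_Id_Add_square_zero:
  assumes "n \<in> Hom C Z Z" "n \<cdot> n = Zero C Z Z"
  shows "is_iso C (Id C Z \<boxplus> n)"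
proof -
  have Z: "Z \<in> Obj C" using assms Hom_Obj by blast
  note I = Id_in_Hom[OF Z]
  note m = Neg_in_Hom[OF assms(1)]
  note In = Add_in_Hom[OF I assms(1)]
  note Im = Add_in_Hom[OF I m]
  have mn: "Neg C n \<cdot> n = Zero C Z Z" "n \<cdot> Neg C n = Zero C Z Z"
    using assms Z by (simp_all add: Comp_Neg_left[OF assms(1) assms(1)]
      Comp_Neg_right[OF assms(1) assms(1)] Neg_Zero)
  have 1: "(Id C Z \<boxplus> Neg C n) \<cdot> (Id C Z \<boxplus> n) = Id C Z"
    using Comp_Add_left[OF In I m] Comp_Add_right[OF I assms(1) m] Id_left[OF In] Id_right[OF m]
      mn Add_Zero_right[OF m] Add_assoc[OF I assms(1) m] Add_Neg[OF assms(1)] Add_Zero_right[OF I]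
    by simp
  have 2: "(Id C Z \<boxplus> n) \<cdot> (Id C Z \<boxplus> Neg C n) = Id C Z"
    using Comp_Add_right[OF I m In] Comp_Add_left[OF m I assms(1)] Id_right[OF In] Id_left[OF m]
      mn Add_Zero_right[OF m] Add_assoc[OF I assms(1) m] Add_Neg[OF assms(1)] Add_Zero_right[OF I]
    by simp
  show ?thesis by (rule is_isoI[OF In Im 1 2])
qed

end

section \<open>Direct sums and matrices\<close>

context additive_category
begin

lemma biproduct_facts:
  assumes "is_biproduct C A B S"
  shows "inj1 S \<in> Hom C A (sum_obj S)" "inj2 S \<in> Hom C B (sum_obj S)"
    "proj1 S \<in> Hom C (sum_obj S) A" "proj2 S \<in> Hom C (sum_obj S) B"
    "proj1 S \<cdot> inj1 S = Id C A" "proj2 S \<cdot> inj2 S = Id C B"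
    "proj2 S \<cdot> inj1 S = Zero C A B" "proj1 S \<cdot> inj2 S = Zero C B A"
  using assms by (cases S; simp)+

lemma Comp_Add4_right:
  assumes "f1 \<in> Hom C X Y" "f2 \<in> Hom C X Y" "f3 \<in> Hom C X Y" "f4 \<in> Hom C X Y" "g \<in> Hom C Y Z"
  shows "g \<cdot> ((f1 \<boxplus> f2) \<boxplus> (f3 \<boxplus> f4)) = ((g \<cdot> f1) \<boxplus> (g \<cdot> f2)) \<boxplus> ((g \<cdot> f3) \<boxplus> (g \<cdot> f4))"
  using Comp_Add_right[OF Add_in_Hom[OF assms(1,2)] Add_in_Hom[OF assms(3,4)] assms(5)]
    Comp_Add_right[OF assms(1,2,5)] Comp_Add_right[OF assms(3,4,5)] by simp

lemma Comp_Add4_left: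
  assumes "g1 \<in> Hom C Y Z" "g2 \<in> Hom C Y Z" "g3 \<in> Hom C Y Z" "g4 \<in> Hom C Y Z" "f \<in> Hom C X Y"
  shows "((g1 \<boxplus> g2) \<boxplus> (g3 \<boxplus> g4)) \<cdot> f = ((g1 \<cdot> f) \<boxplus> (g2 \<cdot> f)) \<boxplus> ((g3 \<cdot> f) \<boxplus> (g4 \<cdot> f))"
  using Comp_Add_left[OF assms(5) Add_in_Hom[OF assms(1,2)] Add_in_Hom[OF assms(3,4)]]
    Comp_Add_left[OF assms(5,1,2)] Comp_Add_left[OF assms(5,3,4)] by simp

text \<open>The projection extracts the first row and the injections the two columns. The lift is
  computed entirely from these entries of the cone maps.\<close>

lemma matrix_map_Comp:
  assumes S: "is_biproduct C A B S" and S': "is_biproduct C A' B' S'"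
    and a: "a \<in> Hom C A A'" and b: "b \<in> Hom C B A'" and c: "c \<in> Hom C A B'"
    and d: "d \<in> Hom C B B'"
  shows "proj1 S' \<cdot> matrix_map C S S' a b c d = (a \<cdot> proj1 S) \<boxplus> (b \<cdot> proj2 S)"
    and "matrix_map C S S' a b c d \<cdot> inj1 S = (inj1 S' \<cdot> a) \<boxplus> (inj2 S' \<cdot> c)"
    and "matrix_map C S S' a b c d \<cdot> inj2 S = (inj1 S' \<cdot> b) \<boxplus> (inj2 S' \<cdot> d)"
proof -
  note s = biproduct_facts[OF S] and s' = biproduct_facts[OF S']
  have obj: "A \<in> Obj C" "B \<in> Obj C" "sum_obj S \<in> Obj C" "A' \<in> Obj C" "sum_obj S' \<in> Obj C"
    using Hom_Obj s(1,2) s'(1) by blast+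
  note ia = Comp_in_Hom[OF a s'(1)] and ib = Comp_in_Hom[OF b s'(1)]
    and jc = Comp_in_Hom[OF c s'(2)] and jd = Comp_in_Hom[OF d s'(2)]
  note t = Comp_in_Hom[OF s(3) ia] Comp_in_Hom[OF s(4) ib]
    Comp_in_Hom[OF s(3) jc] Comp_in_Hom[OF s(4) jd]
  note ap = Comp_in_Hom[OF s(3) a] and bq = Comp_in_Hom[OF s(4) b]
  have inj1: "proj1 S' \<cdot> (inj1 S' \<cdot> x \<cdot> r) = x \<cdot> r"
    if "x \<in> Hom C D A'" "r \<in> Hom C (sum_obj S) D" for x r D
    using Comp_assoc[OF that(2) that(1) s'(1)] Comp_assoc[OF Comp_in_Hom[OF that(2,1)] s'(1) s'(3)]
      s'(5) Id_left[OF Comp_in_Hom[OF that(2,1)]] by simp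
  have inj2: "proj1 S' \<cdot> (inj2 S' \<cdot> x \<cdot> r) = Zero C (sum_obj S) A'"
    if "x \<in> Hom C D B'" "r \<in> Hom C (sum_obj S) D" for x r D
    using Comp_assoc[OF that(2) that(1) s'(2)] Comp_assoc[OF Comp_in_Hom[OF that(2,1)] s'(2) s'(3)]
      s'(8) Comp_Zero_left[OF Comp_in_Hom[OF that(2,1)] obj(4)] by simp
  show "proj1 S' \<cdot> matrix_map C S S' a b c d = (a \<cdot> proj1 S) \<boxplus> (b \<cdot> proj2 S)"
    unfolding matrix_map_def Comp_Add4_right[OF t s'(3)]
    using inj1[OF a s(3)] inj1[OF b s(4)] inj2[OF c s(3)] inj2[OF d s(4)]
      Add_Zero_right[OF Zero_in_Hom[OF obj(3,4)]] Add_Zero_right[OF Add_in_Hom[OF ap bq]]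
    by simp
  have one: "(m \<cdot> r) \<cdot> i = m"
    if "m \<in> Hom C D (sum_obj S')" "r \<in> Hom C (sum_obj S) D" "i \<in> Hom C D (sum_obj S)"
      "r \<cdot> i = Id C D" for m r i D
    using Comp_assoc[OF that(3,2,1)] that(4) Id_right[OF that(1)] by simp
  have zero: "(m \<cdot> r) \<cdot> i = Zero C E (sum_obj S')"
    if "m \<in> Hom C D (sum_obj S')" "r \<in> Hom C (sum_obj S) D" "i \<in> Hom C E (sum_obj S)"
      "r \<cdot> i = Zero C E D" for m r i D E
    using Comp_assoc[OF that(3,2,1)] that(4) Comp_Zero_right[OF Hom_Obj(1)[OF that(3)] that(1)]
    by simp
  show "matrix_map C S S' a b c d \<cdot> inj1 S = (inj1 S' \<cdot> a) \<boxplus> (inj2 S' \<cdot> c)"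
    unfolding matrix_map_def Comp_Add4_left[OF t s(1)]
    using one[OF ia s(3,1,5)] one[OF jc s(3,1,5)] zero[OF ib s(4,1,7)] zero[OF jd s(4,1,7)]
      Add_Zero_right[OF ia] Add_Zero_right[OF jc]
    by simp
  show "matrix_map C S S' a b c d \<cdot> inj2 S = (inj1 S' \<cdot> b) \<boxplus> (inj2 S' \<cdot> d)"
    unfolding matrix_map_def Comp_Add4_left[OF t s(2)]
    using one[OF ib s(4,2,6)] one[OF jd s(4,2,6)] zero[OF ia s(3,2,8)] zero[OF jc s(3,2,8)]
      Add_Zero_left[OF ib] Add_Zero_left[OF jd]
    by simp
qed

end

section \<open>Exact triangles: uniqueness of cofibres and transport of octahedra\<close>

context triangulated_category
begin

lemma susp_functor: "is_functor T T (susp_obj T) (susp_map T)"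
  using susp_equivalence by (simp add: equivalence_functor_def)

lemmas susp_Hom = functor_Hom[OF susp_functor]
lemmas susp_Comp = functor_Comp[OF susp_functor]
lemmas susp_Id = functor_Id[OF susp_functor]
lemmas susp_faithful =
  equivalence_functor_faithful[OF category_axioms category_axioms susp_equivalence]
lemmas susp_full =
  equivalence_functor_full[OF category_axioms category_axioms susp_equivalence]

lemma susp_Obj: "X \<in> Obj T \<Longrightarrow> susp_obj T X \<in> Obj T"
  using susp_functor by (simp add: is_functor_def)

lemma susp_Zero:
  assumes "X \<in> Obj T" "Y \<in> Obj T"
  shows "susp_map T (Zero T X Y) = Zero T (susp_obj T X) (susp_obj T Y)"
proof -
  note z = Zero_in_Hom[OF assms]
  show ?thesis
    using susp_additive[OF z z] Add_Zero_left[OF z] idempotent_Add_Zero[OF susp_Hom[OF z]] by simp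
qed

lemma susp_zero_object:
  assumes "zero_object T Z"
  shows "zero_object T (susp_obj T Z)"
proof (rule zero_objectI)
  have Z: "Z \<in> Obj T" using assms by (simp add: zero_object_def)
  then show "susp_obj T Z \<in> Obj T" by (rule susp_Obj)
  show "Id T (susp_obj T Z) = Zero T (susp_obj T Z) (susp_obj T Z)"
    using zero_object_Hom_to[OF assms Id_in_Hom[OF Z]] susp_Id[OF Z] susp_Zero[OF Z Z] by simp
qed

lemma Exact_Hom:
  assumes "Triangle X Y Z u v w \<in> Exact T"
  shows "u \<in> Hom T X Y" "v \<in> Hom T Y Z" "w \<in> Hom T Z (susp_obj T X)"
  using Exact_sequence[OF assms] by auto

lemma Exact_rotate:
  assumes "Triangle X Y Z u v w \<in> Exact T"
  shows "Triangle Y Z (susp_obj T X) v w (Neg T (susp_map T u)) \<in> Exact T"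
  using rotation[OF Exact_sequence[OF assms]] assms by simp

text \<open>Mapping the triangle X = X -> 0 to the given one by id and \<open>u\<close> exhibits
  \<open>v \<cdot> u\<close> as a composite through a zero object.\<close>

lemma Exact_Comp_Zero:
  assumes "Triangle X Y Z u v w \<in> Exact T"
  shows "v \<cdot> u = Zero T X Z"
proof -
  note u = Exact_Hom(1)[OF assms]
  have X: "X \<in> Obj T" using Hom_Obj u by blast
  have Z: "Z \<in> Obj T" using Hom_Obj Exact_Hom(2)[OF assms] by blast
  obtain O' where O': "zero_object T O'" using ex_zero_object by blast
  have "u \<cdot> Id T X = u \<cdot> Id T X" ..
  from fill_in[OF Exact_Id[OF X O'] assms Id_in_Hom[OF X] u this]
  obtain h where h: "h \<in> Hom T O' Z" "h \<cdot> Zero T X O' = v \<cdot> u"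
    by auto
  show ?thesis using h Comp_Zero_right[OF X h(1)] by simp
qed

text \<open>Its rotation is the identity triangle on \<open>W\<close> with zero object the
  suspension of \<open>Z\<close>, so the rotation axiom is read backwards.\<close>

lemma Exact_Zero_Id:
  assumes "W \<in> Obj T" "zero_object T Z"
  shows "Triangle Z W W (Zero T Z W) (Id T W) (Zero T W (susp_obj T Z)) \<in> Exact T"
proof -
  have Z: "Z \<in> Obj T" using assms by (simp add: zero_object_def)
  have "is_sequence T (Triangle Z W W (Zero T Z W) (Id T W) (Zero T W (susp_obj T Z)))"
    using assms Z by (simp add: Zero_in_Hom Id_in_Hom susp_Obj)
  from rotation[OF this] show ?thesis
    using Exact_Id[OF assms(1) susp_zero_object[OF assms(2)]] assms(1) Z
    by (simp add: susp_Zero Neg_Zero susp_Obj)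
qed

text \<open>This is exactness of Hom(-, W): since \<open>n\<close> kills \<open>v\<close>, the
  rotated triangle maps to 0 -> W = W, and the third component of that map is
  \<open>s\<close>.\<close>

lemma Exact_factor:
  assumes "Triangle X Y Z u v w \<in> Exact T" "n \<in> Hom T Z W" "n \<cdot> v = Zero T Y W"
  obtains s where "s \<in> Hom T (susp_obj T X) W" "n = s \<cdot> w"
proof -
  note uvw = Exact_Hom[OF assms(1)]
  obtain O' where O': "zero_object T O'" using ex_zero_object by blast
  have Y: "Y \<in> Obj T" and W: "W \<in> Obj T" and "O' \<in> Obj T"
    using Hom_Obj uvw assms(2) O' by (auto simp: zero_object_def)
  then have z: "Zero T Y O' \<in> Hom T Y O'" "Zero T O' W \<in> Hom T O' W"
    using Zero_in_Hom by blast+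
  have "n \<cdot> v = Zero T O' W \<cdot> Zero T Y O'"
    using assms(3) Comp_Zero_left[OF z(1) W] by simp
  from fill_in[OF Exact_rotate[OF assms(1)] Exact_Zero_Id[OF W O'] z(1) assms(2) this]
  obtain s where "s \<in> Hom T (susp_obj T X) W" "s \<cdot> w = Id T W \<cdot> n"
    by auto
  then show thesis using that Id_left[OF assms(2)] by simp
qed

text \<open>
  The difference \<open>n = e - id\<close> factors as \<open>s w\<close>, and \<open>w n = 0\<close>, so \<open>n\<^sup>2 = 0\<close>.
\<close>

lemma Exact_endo_iso:
  assumes "Triangle X Y Z u v w \<in> Exact T" "e \<in> Hom T Z Z" "e \<cdot> v = v" "w \<cdot> e = w"
  shows "is_iso T e"
proof -
  note uvw = Exact_Hom[OF assms(1)]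
  have Z: "Z \<in> Obj T" using Hom_Obj assms(2) by blast
  note I = Id_in_Hom[OF Z]
  note m = Neg_in_Hom[OF I]
  define n where "n = e \<boxplus> Neg T (Id T Z)"
  have n: "n \<in> Hom T Z Z" unfolding n_def by (rule Add_in_Hom[OF assms(2) m])
  have nv: "n \<cdot> v = Zero T Y Z"
    unfolding n_def
    using Comp_Add_left[OF uvw(2) assms(2) m] Comp_Neg_left[OF uvw(2) I] Id_left[OF uvw(2)]
      assms(3) Add_Neg[OF uvw(2)] by simp
  have wn: "w \<cdot> n = Zero T Z (susp_obj T X)"
    unfolding n_def
    using Comp_Add_right[OF assms(2) m uvw(3)] Comp_Neg_right[OF I uvw(3)] Id_right[OF uvw(3)]
      assms(4) Add_Neg[OF uvw(3)] by simp
  obtain s where s: "s \<in> Hom T (susp_obj T X) Z" "n = s \<cdot> w"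
    using Exact_factor[OF assms(1) n nv] .
  have "n \<cdot> n = s \<cdot> (w \<cdot> n)"
    using Comp_assoc[OF n uvw(3) s(1)] s(2) by simp
  then have "n \<cdot> n = Zero T Z Z"
    using wn Comp_Zero_right[OF Z s(1)] by simp
  from is_iso_Id_Add_square_zero[OF n this]
  have "is_iso T (Id T Z \<boxplus> n)" .
  moreover have "Id T Z \<boxplus> n = e"
    using Add_commute[OF I n] Add_assoc[OF assms(2) m I] Add_commute[OF m I] Add_Neg[OF I]
      Add_Zero_right[OF assms(2)] unfolding n_def by simp
  ultimately show ?thesis by simp
qed

text \<open>A fill-in \<open>k\<close> in the opposite direction need not invert \<open>h\<close>,
  but \<open>k \<cdot> h\<close> and \<open>h \<cdot> k\<close> are endomorphisms compatible with
  the triangle maps, so both are invertible by \<open>Exact_endo_iso\<close>.\<close>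

lemma triangle_map_Id_iso:
  assumes E: "Triangle X Y Z u v w \<in> Exact T" and E': "Triangle X Y Z' u v' w' \<in> Exact T"
    and m: "triangle_map T (Triangle X Y Z u v w) (Triangle X Y Z' u v' w') (Id T X) (Id T Y) h"
  shows "is_iso T h"
proof -
  note uvw = Exact_Hom[OF E] and uvw' = Exact_Hom[OF E']
  have X: "X \<in> Obj T" and Y: "Y \<in> Obj T" using Hom_Obj uvw by blast+
  note simps = Id_left[OF uvw(3)] Id_left[OF uvw'(3)] Id_right[OF uvw(2)] Id_right[OF uvw'(2)]
    susp_Id[OF X]
  have h: "h \<in> Hom T Z Z'" "h \<cdot> v = v'" "w' \<cdot> h = w"
    using m simps by auto
  have "Id T Y \<cdot> u = u \<cdot> Id T X" using Id_left Id_right uvw(1) by simp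
  from fill_in[OF E' E Id_in_Hom[OF X] Id_in_Hom[OF Y] this]
  obtain k where k: "k \<in> Hom T Z' Z" "k \<cdot> v' = v" "w \<cdot> k = w'"
    using simps by auto
  have "is_iso T (k \<cdot> h)"
    using Comp_assoc[OF uvw(2) h(1) k(1)] Comp_assoc[OF h(1) k(1) uvw(3)] h k
    by (intro Exact_endo_iso[OF E Comp_in_Hom[OF h(1) k(1)]]) auto
  moreover have "is_iso T (h \<cdot> k)"
    using Comp_assoc[OF uvw'(2) k(1) h(1)] Comp_assoc[OF k(1) h(1) uvw'(3)] h k
    by (intro Exact_endo_iso[OF E' Comp_in_Hom[OF k(1) h(1)]]) auto
  ultimately show ?thesis
    using is_iso_left_right_inverse[OF h(1) k(1) k(1)] by blast
qed

lemma ex_triangle_map_Id: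
  assumes "Triangle X Y Z u v w \<in> Exact T" "Triangle X Y Z' u v' w' \<in> Exact T"
  shows "\<exists>h. triangle_map T (Triangle X Y Z u v w) (Triangle X Y Z' u v' w') (Id T X) (Id T Y) h"
proof -
  note u = Exact_Hom(1)[OF assms(1)]
  have X: "X \<in> Obj T" and Y: "Y \<in> Obj T" using Hom_Obj u by blast+
  have "Id T Y \<cdot> u = u \<cdot> Id T X" using Id_left Id_right u by simp
  from fill_in[OF assms Id_in_Hom[OF X] Id_in_Hom[OF Y] this] show ?thesis .
qed

text \<open>The comparisons of cofibres are invertible, so \<open>\<alpha>\<close> and
  \<open>\<beta>\<close> can be conjugated by them. The comparisons are prescribed by the caller
  rather than produced here, because two octahedra will have to be moved compatibly; the last two
  conclusions record the effect.\<close>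

lemma octahedron_transport:
  assumes oct: "octahedron T (Triangle P Q Ca a a' a'') (Triangle Q R Cb b b' b'')
      (Triangle P R Cc c c' c'') (Triangle Ca Cc Cb \<alpha> \<beta> \<gamma>)"
    and Ea: "Triangle P Q Da a d' d'' \<in> Exact T"
    and Eb: "Triangle Q R Db b e' e'' \<in> Exact T"
    and Ec: "Triangle P R Dc c r' r'' \<in> Exact T"
    and mx: "triangle_map T (Triangle P Q Ca a a' a'') (Triangle P Q Da a d' d'')
      (Id T P) (Id T Q) x"
    and my: "triangle_map T (Triangle Q R Cb b b' b'') (Triangle Q R Db b e' e'')
      (Id T Q) (Id T R) y"
    and mz: "triangle_map T (Triangle P R Cc c c' c'') (Triangle P R Dc c r' r'')
      (Id T P) (Id T R) z"
  obtains \<alpha>' \<beta>' \<gamma>' where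
    "octahedron T (Triangle P Q Da a d' d'') (Triangle Q R Db b e' e'')
      (Triangle P R Dc c r' r'') (Triangle Da Dc Db \<alpha>' \<beta>' \<gamma>')"
    "\<alpha>' \<cdot> x = z \<cdot> \<alpha>" "\<beta>' \<cdot> z = y \<cdot> \<beta>"
proof -
  have Fa: "Triangle P Q Ca a a' a'' \<in> Exact T" and Fb: "Triangle Q R Cb b b' b'' \<in> Exact T"
    and Fc: "Triangle P R Cc c c' c'' \<in> Exact T" and Fd: "Triangle Ca Cc Cb \<alpha> \<beta> \<gamma> \<in> Exact T"
    and c: "c = b \<cdot> a"
    and o1: "\<alpha> \<cdot> a' = c' \<cdot> b" and o2: "c'' \<cdot> \<alpha> = a''" and o3: "\<beta> \<cdot> c' = b'"
    and o4: "\<gamma> = susp_map T a' \<cdot> b''" and o5: "b'' \<cdot> \<beta> = susp_map T a \<cdot> c''"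
    using oct by auto
  note ha = Exact_Hom[OF Fa] and hb = Exact_Hom[OF Fb] and hc = Exact_Hom[OF Fc]
    and hd = Exact_Hom[OF Fd] and ka = Exact_Hom[OF Ea] and kb = Exact_Hom[OF Eb]
    and kc = Exact_Hom[OF Ec]
  have P: "P \<in> Obj T" and Q: "Q \<in> Obj T" using Hom_Obj ha by blast+
  note ids = susp_Id[OF P] susp_Id[OF Q]
    Id_right[OF ka(2)] Id_right[OF kb(2)] Id_right[OF kc(2)]
    Id_left[OF ha(3)] Id_left[OF hb(3)] Id_left[OF hc(3)]
  have x: "x \<in> Hom T Ca Da" "x \<cdot> a' = d'" "a'' = d'' \<cdot> x" using mx ids by auto
  have y: "y \<in> Hom T Cb Db" "y \<cdot> b' = e'" "b'' = e'' \<cdot> y" using my ids by auto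
  have z: "z \<in> Hom T Cc Dc" "z \<cdot> c' = r'" "c'' = r'' \<cdot> z" using mz ids by auto
  have ix: "is_iso T x" and iy: "is_iso T y" and iz: "is_iso T z"
    using triangle_map_Id_iso[OF Fa Ea mx] triangle_map_Id_iso[OF Fb Eb my]
      triangle_map_Id_iso[OF Fc Ec mz] by auto
  obtain xi where xi: "xi \<in> Hom T Da Ca" "xi \<cdot> x = Id T Ca" "x \<cdot> xi = Id T Da"
    using is_isoE[OF ix x(1)] .
  obtain zi where zi: "zi \<in> Hom T Dc Cc" "zi \<cdot> z = Id T Cc" "z \<cdot> zi = Id T Dc"
    using is_isoE[OF iz z(1)] .
  have xa: "xi \<cdot> d' = a'"
    using Comp_assoc[OF ha(2) x(1) xi(1)] x(2) xi(2) Id_left[OF ha(2)] by simp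
  have xa': "a'' \<cdot> xi = d''"
    using Comp_assoc[OF xi(1) x(1) ka(3)] x(3) xi(3) Id_right[OF ka(3)] by simp
  have zc: "zi \<cdot> r' = c'"
    using Comp_assoc[OF hc(2) z(1) zi(1)] z(2) zi(2) Id_left[OF hc(2)] by simp
  have zc': "c'' \<cdot> zi = r''"
    using Comp_assoc[OF zi(1) z(1) kc(3)] z(3) zi(3) Id_right[OF kc(3)] by simp
  define \<alpha>' where "\<alpha>' = (z \<cdot> \<alpha>) \<cdot> xi"
  define \<beta>' where "\<beta>' = (y \<cdot> \<beta>) \<cdot> zi"
  \<comment> \<open>An octahedron dictates its third map, so this formula replaces conjugation of
    \<open>\<gamma>\<close>, and the third square must be checked by hand.\<close>
  define \<gamma>' where "\<gamma>' = susp_map T d' \<cdot> e''"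
  note z\<alpha> = Comp_in_Hom[OF hd(1) z(1)] and y\<beta> = Comp_in_Hom[OF hd(2) y(1)]
  have \<alpha>': "\<alpha>' \<in> Hom T Da Dc" unfolding \<alpha>'_def by (rule Comp_in_Hom[OF xi(1) z\<alpha>])
  have \<beta>': "\<beta>' \<in> Hom T Dc Db" unfolding \<beta>'_def by (rule Comp_in_Hom[OF zi(1) y\<beta>])
  have \<gamma>': "\<gamma>' \<in> Hom T Db (susp_obj T Da)"
    unfolding \<gamma>'_def by (rule Comp_in_Hom[OF kb(3) susp_Hom[OF ka(2)]])
  have sq1: "\<alpha>' \<cdot> x = z \<cdot> \<alpha>"
    using Comp_assoc[OF x(1) xi(1) z\<alpha>] xi(2) Id_right[OF z\<alpha>] by (simp add: \<alpha>'_def)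
  have sq2: "\<beta>' \<cdot> z = y \<cdot> \<beta>"
    using Comp_assoc[OF z(1) zi(1) y\<beta>] zi(2) Id_right[OF y\<beta>] by (simp add: \<beta>'_def)
  have sq3: "susp_map T x \<cdot> \<gamma> = \<gamma>' \<cdot> y"
  proof -
    have "susp_map T x \<cdot> \<gamma> = susp_map T (x \<cdot> a') \<cdot> b''"
      unfolding o4 susp_Comp[OF ha(2) x(1)]
      using Comp_assoc[OF hb(3) susp_Hom[OF ha(2)] susp_Hom[OF x(1)]] by simp
    also have "\<dots> = \<gamma>' \<cdot> y"
      unfolding \<gamma>'_def x(2) y(3) using Comp_assoc[OF y(1) kb(3) susp_Hom[OF ka(2)]] by simp
    finally show ?thesis .
  qed
  have E: "Triangle Da Dc Db \<alpha>' \<beta>' \<gamma>' \<in> Exact T"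
  proof (rule Exact_iso[OF Fd _ _ ix iz iy])
    show "is_sequence T (Triangle Da Dc Db \<alpha>' \<beta>' \<gamma>')" using \<alpha>' \<beta>' \<gamma>' by simp
    show "triangle_map T (Triangle Ca Cc Cb \<alpha> \<beta> \<gamma>) (Triangle Da Dc Db \<alpha>' \<beta>' \<gamma>') x z y"
      using x(1) y(1) z(1) sq1 sq2 sq3 by simp
  qed
  have p1: "\<alpha>' \<cdot> d' = r' \<cdot> b"
  proof -
    have "\<alpha>' \<cdot> d' = z \<cdot> (\<alpha> \<cdot> a')"
      unfolding \<alpha>'_def Comp_assoc[OF ka(2) xi(1) z\<alpha>] xa
      by (rule Comp_assoc[OF ha(2) hd(1) z(1)])
    also have "\<dots> = r' \<cdot> b"
      unfolding o1 z(2)[symmetric] by (rule Comp_assoc[OF hb(1) hc(2) z(1), symmetric])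
    finally show ?thesis .
  qed
  have p2: "r'' \<cdot> \<alpha>' = d''"
  proof -
    have "r'' \<cdot> \<alpha>' = ((r'' \<cdot> z) \<cdot> \<alpha>) \<cdot> xi"
      unfolding \<alpha>'_def Comp_assoc[OF xi(1) z\<alpha> kc(3), symmetric]
      using Comp_assoc[OF hd(1) z(1) kc(3)] by simp
    then show ?thesis unfolding z(3)[symmetric] o2 xa' .
  qed
  have p3: "\<beta>' \<cdot> r' = e'"
  proof -
    have "\<beta>' \<cdot> r' = y \<cdot> (\<beta> \<cdot> c')"
      unfolding \<beta>'_def Comp_assoc[OF kc(2) zi(1) y\<beta>] zc
      by (rule Comp_assoc[OF hc(2) hd(2) y(1)])
    then show ?thesis unfolding o3 y(2) .
  qed
  have p5: "e'' \<cdot> \<beta>' = susp_map T a \<cdot> r''"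
  proof -
    have "e'' \<cdot> \<beta>' = ((e'' \<cdot> y) \<cdot> \<beta>) \<cdot> zi"
      unfolding \<beta>'_def Comp_assoc[OF zi(1) y\<beta> kb(3), symmetric]
      using Comp_assoc[OF hd(2) y(1) kb(3)] by simp
    also have "\<dots> = susp_map T a \<cdot> (c'' \<cdot> zi)"
      unfolding y(3)[symmetric] o5 by (rule Comp_assoc[OF zi(1) hc(3) susp_Hom[OF ha(1)]])
    finally show ?thesis unfolding zc' .
  qed
  have "octahedron T (Triangle P Q Da a d' d'') (Triangle Q R Db b e' e'')
      (Triangle P R Dc c r' r'') (Triangle Da Dc Db \<alpha>' \<beta>' \<gamma>')"
    using c Ea Eb Ec E p1 p2 p3 p5 \<gamma>'_def by simp
  then show thesis using sq1 sq2 by (rule that)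
qed

section \<open>From a good map with zero third component to a lift\<close>

lemma susp_biprod_is_biproduct:
  assumes "is_biproduct T A B S"
  shows "is_biproduct T (susp_obj T A) (susp_obj T B) (susp_biprod T S)"
proof -
  obtain D i j p q where S: "S = Biprod D i j p q" by (cases S)
  have h: "i \<in> Hom T A D" "j \<in> Hom T B D" "p \<in> Hom T D A" "q \<in> Hom T D B"
    and e: "p \<cdot> i = Id T A" "q \<cdot> j = Id T B" "q \<cdot> i = Zero T A B" "p \<cdot> j = Zero T B A"
      "(i \<cdot> p) \<boxplus> (j \<cdot> q) = Id T D"
    using assms S by auto
  have obj: "A \<in> Obj T" "B \<in> Obj T" "D \<in> Obj T" using Hom_Obj h by blast+
  show ?thesis
    using e obj
    by (simp add: S susp_Hom[OF h(1)] susp_Hom[OF h(2)] susp_Hom[OF h(3)] susp_Hom[OF h(4)]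
        susp_Comp[OF h(1,3), symmetric] susp_Comp[OF h(2,4), symmetric]
        susp_Comp[OF h(1,4), symmetric] susp_Comp[OF h(2,3), symmetric]
        susp_Comp[OF h(3,1), symmetric] susp_Comp[OF h(4,2), symmetric]
        susp_additive[OF Comp_in_Hom[OF h(3,1)] Comp_in_Hom[OF h(4,2)], symmetric]
        susp_Id susp_Zero)
qed

text \<open>
  Since the third component is zero, the first projections of \<open>Y' \<oplus> Z\<close> and \<open>Z' \<oplus> \<Sigma>X\<close> commute
  with the cone and the target triangle. They extend to a map \<open>[A B]\<close> out of \<open>\<Sigma>(X' \<oplus> Y)\<close>, where
  \<open>A\<close> is invertible and \<open>A\<^sup>-\<^sup>1 B\<close> is the suspension of the lift.
\<close>

lemma good_Zero_lift:
  assumes E: "Triangle X Y Z u v w \<in> Exact T" and E': "Triangle X' Y' Z' u' v' w' \<in> Exact T"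
    and f: "f \<in> Hom T X X'" and g: "g \<in> Hom T Y Y'"
    and good: "good T (Triangle X Y Z u v w) (Triangle X' Y' Z' u' v' w') f g (Zero T Z Z')"
  obtains \<theta> where "\<theta> \<in> Hom T Y X'" "\<theta> \<cdot> u = f" "u' \<cdot> \<theta> = g"
proof -
  note h = Exact_Hom[OF E] and h' = Exact_Hom[OF E']
  have obj: "X \<in> Obj T" "Y \<in> Obj T" "Z \<in> Obj T" "X' \<in> Obj T" "Y' \<in> Obj T" "Z' \<in> Obj T"
    using Hom_Obj h h' by blast+
  note sobj = obj[THEN susp_Obj]
  note z = Zero_in_Hom
  obtain S1 S2 S3 where S1: "is_biproduct T X' Y S1" and S2: "is_biproduct T Y' Z S2"
    and S3: "is_biproduct T Z' (susp_obj T X) S3"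
    and cone: "mapping_cone T S1 S2 S3 (Triangle X Y Z u v w) (Triangle X' Y' Z' u' v' w')
      f g (Zero T Z Z') \<in> Exact T"
    using good by auto
  define U where "U = matrix_map T S1 S2 u' g (Zero T X' Z) (Neg T v)"
  define V where "V = matrix_map T S2 S3 v' (Zero T Z Z') (Zero T Y' (susp_obj T X)) (Neg T w)"
  define W where "W = matrix_map T S3 (susp_biprod T S1) w' (susp_map T f)
    (Zero T Z' (susp_obj T Y)) (Neg T (susp_map T u))"
  have EC: "Triangle (sum_obj S1) (sum_obj S2) (sum_obj S3) U V W \<in> Exact T"
    using cone by (simp add: U_def V_def W_def)
  note hC = Exact_Hom[OF EC]
  note s1 = biproduct_facts[OF S1] and s2 = biproduct_facts[OF S2] and s3 = biproduct_facts[OF S3]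
  have susp_S1: "sum_obj (susp_biprod T S1) = susp_obj T (sum_obj S1)"
    "inj1 (susp_biprod T S1) = susp_map T (inj1 S1)"
    "inj2 (susp_biprod T S1) = susp_map T (inj2 S1)"
    by (cases S1; simp)+
  note su = susp_Hom[OF h(1)] and su' = susp_Hom[OF h'(1)] and sf = susp_Hom[OF f]
    and si = susp_Hom[OF s1(1)] and sj = susp_Hom[OF s1(2)] and sp = susp_Hom[OF s2(3)]
    and sU = susp_Hom[OF hC(1)]
  note U = matrix_map_Comp[OF S1 S2 h'(1) g z[OF obj(4,3)] Neg_in_Hom[OF h(2)], folded U_def]
  note V = matrix_map_Comp[OF S2 S3 h'(2) z[OF obj(3,6)] z[OF obj(5) sobj(1)] Neg_in_Hom[OF h(3)],
      folded V_def]
  \<comment> \<open>The last cone map ends in a suspended direct sum, which is again a direct sum,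
    so the column formulas apply to it too.\<close>
  note W = matrix_map_Comp[OF S3 susp_biprod_is_biproduct[OF S1] h'(3) sf z[OF obj(6) sobj(2)]
      Neg_in_Hom[OF su], folded W_def, unfolded susp_S1]
  have "proj1 S3 \<cdot> V = v' \<cdot> proj1 S2"
    using V(1) Comp_Zero_left[OF s2(4) obj(6)] Add_Zero_right[OF Comp_in_Hom[OF s2(3) h'(2)]]
    by simp
  \<comment> \<open>The known square is the middle one, while the axiom starts from the first
    square. Rotating once makes it the first and puts the new component on the suspended
    sum.\<close>
  from fill_in[OF Exact_rotate[OF EC] Exact_rotate[OF E'] s2(3) s3(3) this]
  obtain H where H: "H \<in> Hom T (susp_obj T (sum_obj S1)) (susp_obj T X')"
    and HW: "H \<cdot> W = w' \<cdot> proj1 S3"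
    and uH: "susp_map T (proj1 S2) \<cdot> Neg T (susp_map T U) = Neg T (susp_map T u') \<cdot> H"
    by auto
  have uH: "susp_map T u' \<cdot> H = susp_map T (proj1 S2) \<cdot> susp_map T U"
    using uH Comp_Neg_right[OF sU sp] Comp_Neg_left[OF H su']
      Neg_inject[OF Comp_in_Hom[OF H su'] Comp_in_Hom[OF sU sp]] by simp
  have u'H: "susp_map T u' \<cdot> (H \<cdot> susp_map T k) = susp_map T (proj1 S2 \<cdot> (U \<cdot> k))"
    if k: "k \<in> Hom T D (sum_obj S1)" for k D
  proof -
    have "susp_map T u' \<cdot> (H \<cdot> susp_map T k)
        = (susp_map T (proj1 S2) \<cdot> susp_map T U) \<cdot> susp_map T k"
      using Comp_assoc[OF susp_Hom[OF k] H su'] uH by simp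
    also have "\<dots> = susp_map T (proj1 S2 \<cdot> (U \<cdot> k))"
      using Comp_assoc[OF susp_Hom[OF k] sU sp] susp_Comp[OF k hC(1)]
        susp_Comp[OF Comp_in_Hom[OF k hC(1)] s2(3)] by simp
    finally show ?thesis .
  qed
  define A where "A = H \<cdot> susp_map T (inj1 S1)"
  define B where "B = H \<cdot> susp_map T (inj2 S1)"
  have A: "A \<in> Hom T (susp_obj T X') (susp_obj T X')"
    unfolding A_def by (rule Comp_in_Hom[OF si H])
  have B: "B \<in> Hom T (susp_obj T Y) (susp_obj T X')"
    unfolding B_def by (rule Comp_in_Hom[OF sj H])
  \<comment> \<open>The first row of \<open>U\<close> is (u' g). Composed with the injections it
    turns \<open>uH\<close> into the equations for \<open>A\<close> and \<open>B\<close>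
    separately.\<close>
  have pU: "proj1 S2 \<cdot> (U \<cdot> inj1 S1) = u'" "proj1 S2 \<cdot> (U \<cdot> inj2 S1) = g"
  proof -
    note a = Comp_in_Hom[OF s1(3) h'(1)] and b = Comp_in_Hom[OF s1(4) g]
    show "proj1 S2 \<cdot> (U \<cdot> inj1 S1) = u'"
      using Comp_assoc[OF s1(1) hC(1) s2(3)] U(1) Comp_Add_left[OF s1(1) a b]
        Comp_assoc[OF s1(1,3) h'(1)] Comp_assoc[OF s1(1,4) g] s1(5,7)
        Id_right[OF h'(1)] Comp_Zero_right[OF obj(4) g] Add_Zero_right[OF h'(1)] by simp
    show "proj1 S2 \<cdot> (U \<cdot> inj2 S1) = g"
      using Comp_assoc[OF s1(2) hC(1) s2(3)] U(1) Comp_Add_left[OF s1(2) a b]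
        Comp_assoc[OF s1(2,3) h'(1)] Comp_assoc[OF s1(2,4) g] s1(6,8)
        Id_right[OF g] Comp_Zero_right[OF obj(2) h'(1)] Add_Zero_left[OF g] by simp
  qed
  have uA: "susp_map T u' \<cdot> A = susp_map T u'" and uB: "susp_map T u' \<cdot> B = susp_map T g"
    using u'H[OF s1(1)] u'H[OF s1(2)] pU by (simp_all add: A_def B_def)
  \<comment> \<open>The first column of \<open>W\<close> is (w', 0), so \<open>B\<close> does not
    enter here.\<close>
  have Aw: "A \<cdot> w' = w'"
  proof -
    have "A \<cdot> w' = H \<cdot> (W \<cdot> inj1 S3)"
      unfolding A_def W(2) using Comp_assoc[OF h'(3) si H] Comp_Zero_right[OF obj(6) sj]
        Add_Zero_right[OF Comp_in_Hom[OF h'(3) si]] by simp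
    also have "\<dots> = w' \<cdot> (proj1 S3 \<cdot> inj1 S3)"
      using Comp_assoc[OF s3(1) hC(3) H] HW Comp_assoc[OF s3(1,3) h'(3)] by simp
    finally show ?thesis using s3(5) Id_right[OF h'(3)] by simp
  qed
  note Af = Comp_in_Hom[OF sf A] and Bu = Comp_in_Hom[OF su B]
  \<comment> \<open>The second column of \<open>W\<close> holds the suspensions of f and -u, and the
    projection kills the second summand.\<close>
  have "(A \<cdot> susp_map T f) \<boxplus> Neg T (B \<cdot> susp_map T u) = Zero T (susp_obj T X) (susp_obj T X')"
  proof -
    have "(A \<cdot> susp_map T f) \<boxplus> Neg T (B \<cdot> susp_map T u) = H \<cdot> (W \<cdot> inj2 S3)"
      unfolding A_def B_def W(3)
      using Comp_assoc[OF sf si H] Comp_assoc[OF Neg_in_Hom[OF su] sj H]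
        Comp_Add_right[OF Comp_in_Hom[OF sf si] Comp_in_Hom[OF Neg_in_Hom[OF su] sj] H]
        Comp_Neg_right[OF su B] unfolding B_def by simp
    also have "\<dots> = w' \<cdot> (proj1 S3 \<cdot> inj2 S3)"
      using Comp_assoc[OF s3(2) hC(3) H] HW Comp_assoc[OF s3(2,3) h'(3)] by simp
    finally show ?thesis using s3(8) Comp_Zero_right[OF sobj(1) h'(3)] by simp
  qed
  then have AfBu: "A \<cdot> susp_map T f = B \<cdot> susp_map T u"
    using Neg_unique[OF Af Neg_in_Hom[OF Bu]] Neg_unique[OF Bu Neg_in_Hom[OF Bu] Add_Neg[OF Bu]]
      Neg_inject[OF Af Bu] by simp
  \<comment> \<open>Together with \<open>Aw\<close> this makes \<open>A\<close> an endomorphism of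
    the third object of the rotated target triangle that respects both adjacent maps, hence
    invertible.\<close>
  have "Neg T (susp_map T u') \<cdot> A = Neg T (susp_map T u')"
    using Comp_Neg_left[OF A su'] uA by simp
  from Exact_endo_iso[OF Exact_rotate[OF E'] A Aw this]
  obtain G where G: "G \<in> Hom T (susp_obj T X') (susp_obj T X')"
    and GA: "G \<cdot> A = Id T (susp_obj T X')" and AG: "A \<cdot> G = Id T (susp_obj T X')"
    using is_isoE A by metis
  \<comment> \<open>\<open>B\<close> itself satisfies its equation with u only up to the factor
    \<open>A\<close>, which \<open>G\<close> removes. The equation with u' survives because
    \<open>uA\<close> also gives \<open>uG\<close>.\<close>
  obtain \<theta> where \<theta>: "\<theta> \<in> Hom T Y X'" "susp_map T \<theta> = G \<cdot> B"
    using susp_full[OF obj(2,4) Comp_in_Hom[OF B G]] .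
  have "susp_map T (\<theta> \<cdot> u) = G \<cdot> (A \<cdot> susp_map T f)"
    using susp_Comp[OF h(1) \<theta>(1)] \<theta>(2) Comp_assoc[OF su B G] AfBu by simp
  also have "\<dots> = susp_map T f"
    using Comp_assoc[OF sf A G] GA Id_left[OF sf] by simp
  finally have 1: "\<theta> \<cdot> u = f"
    by (rule susp_faithful[OF Comp_in_Hom[OF h(1) \<theta>(1)] f])
  have uG: "susp_map T u' \<cdot> G = susp_map T u'"
    using Comp_assoc[OF G A su'] uA AG Id_right[OF su'] by simp
  have "susp_map T (u' \<cdot> \<theta>) = susp_map T g"
    using susp_Comp[OF \<theta>(1) h'(1)] \<theta>(2) Comp_assoc[OF B G su'] uG uB by simp
  then have 2: "u' \<cdot> \<theta> = g"
    by (rule susp_faithful[OF Comp_in_Hom[OF \<theta>(1) h'(1)] g])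
  show thesis by (rule that[OF \<theta>(1) 1 2])
qed

end

section \<open>From a lift to a Verdier good map\<close>

lemma octahedron_based_onE:
  assumes "octahedron_based_on T P Q R a b K"
  obtains Ca a' a'' Cb b' b'' Cc c' c'' \<alpha> \<beta> \<gamma> where
    "K = Octa (Triangle P Q Ca a a' a'') (Triangle Q R Cb b b' b'')
      (Triangle P R Cc (b \<cdot>\<^bsub>T\<^esub> a) c' c'') (Triangle Ca Cc Cb \<alpha> \<beta> \<gamma>)"
    "octahedron T (Triangle P Q Ca a a' a'') (Triangle Q R Cb b b' b'')
      (Triangle P R Cc (b \<cdot>\<^bsub>T\<^esub> a) c' c'') (Triangle Ca Cc Cb \<alpha> \<beta> \<gamma>)"
proof (cases K)
  case (Octa Da Db Dc Dd)
  show thesis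
    using assms that Octa
    by (cases Da; cases Db; cases Dc; cases Dd) (auto simp: octahedron_based_on_def)
qed

context triangulated_category
begin

text \<open>
  The map \<open>(id, \<theta>, id)\<close> from \<open>X \<rightarrow> Y \<rightarrow> Y'\<close> to \<open>X \<rightarrow> X' \<rightarrow> Y'\<close> extends to octahedra
  with an isomorphism \<open>\<psi>\<close> on the cofibres of the common composite. Identifying these cofibres along
  \<open>\<psi>\<close>, the two octahedra satisfy \<open>\<beta>\<^sub>2 \<alpha>\<^sub>1 = \<beta>\<^sub>2 \<alpha>\<^sub>2 \<psi>a = 0\<close>.
\<close>

lemma lift_verdier_good:
  assumes wfo: "weakly_functorial_octahedra T"
    and E: "Triangle X Y Z u v w \<in> Exact T" and E': "Triangle X' Y' Z' u' v' w' \<in> Exact T"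
    and \<theta>: "\<theta> \<in> Hom T Y X'"
  shows "verdier_good T (Triangle X Y Z u v w) (Triangle X' Y' Z' u' v' w')
    (\<theta> \<cdot> u) (u' \<cdot> \<theta>) (Zero T Z Z')"
proof -
  note h = Exact_Hom[OF E] and h' = Exact_Hom[OF E']
  have obj: "X \<in> Obj T" "Y \<in> Obj T" "Z \<in> Obj T" "X' \<in> Obj T" "Y' \<in> Obj T" "Z' \<in> Obj T"
    using Hom_Obj h h' by blast+
  define f where "f = \<theta> \<cdot> u"
  define g where "g = u' \<cdot> \<theta>"
  have f: "f \<in> Hom T X X'" unfolding f_def by (rule Comp_in_Hom[OF h(1) \<theta>])
  have g: "g \<in> Hom T Y Y'" unfolding g_def by (rule Comp_in_Hom[OF \<theta> h'(1)])
  have gu: "u' \<cdot> f = g \<cdot> u"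
    unfolding f_def g_def by (rule Comp_assoc[OF h(1) \<theta> h'(1), symmetric])
  have "\<theta> \<cdot> u = f \<cdot> Id T X" and "Id T Y' \<cdot> g = u' \<cdot> \<theta>"
    using Id_right[OF f] Id_left[OF g] by (simp_all add: f_def g_def)
  with wfo h(1) g f h'(1) Id_in_Hom[OF obj(1)] \<theta> Id_in_Hom[OF obj(5)]
  obtain K L \<psi>a \<psi>b \<psi> where K: "octahedron_based_on T X Y Y' u g K"
    and L: "octahedron_based_on T X X' Y' f u' L"
    and KL: "octahedron_map T K L (Id T X) \<theta> (Id T Y') \<psi>a \<psi>b \<psi>"
    unfolding weakly_functorial_octahedra_def by meson
  obtain Ka ka' ka'' Kb kb' kb'' Kc kc' kc'' \<alpha> \<beta> \<gamma> where
    Keq: "K = Octa (Triangle X Y Ka u ka' ka'') (Triangle Y Y' Kb g kb' kb'')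
      (Triangle X Y' Kc (g \<cdot> u) kc' kc'') (Triangle Ka Kc Kb \<alpha> \<beta> \<gamma>)"
    and Koct: "octahedron T (Triangle X Y Ka u ka' ka'') (Triangle Y Y' Kb g kb' kb'')
      (Triangle X Y' Kc (g \<cdot> u) kc' kc'') (Triangle Ka Kc Kb \<alpha> \<beta> \<gamma>)"
    using octahedron_based_onE[OF K] .
  obtain La la' la'' Lb lb' lb'' Lc lc' lc'' \<alpha>' \<beta>' \<gamma>' where
    Leq: "L = Octa (Triangle X X' La f la' la'') (Triangle X' Y' Lb u' lb' lb'')
      (Triangle X Y' Lc (u' \<cdot> f) lc' lc'') (Triangle La Lc Lb \<alpha>' \<beta>' \<gamma>')"
    and Loct: "octahedron T (Triangle X X' La f la' la'') (Triangle X' Y' Lb u' lb' lb'')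
      (Triangle X Y' Lc (u' \<cdot> f) lc' lc'') (Triangle La Lc Lb \<alpha>' \<beta>' \<gamma>')"
    using octahedron_based_onE[OF L] .
  \<comment> \<open>The two composites are the same map X -> Y', so both octahedra have their third
    triangle on one map and \<open>\<psi>\<close> compares two cofibres of it.\<close>
  note Loct = Loct[unfolded gu]
  have \<psi>: "triangle_map T (Triangle X Y' Kc (g \<cdot> u) kc' kc'') (Triangle X Y' Lc (g \<cdot> u) lc' lc'')
      (Id T X) (Id T Y') \<psi>"
    and \<psi>a: "\<psi>a \<in> Hom T Ka La" "\<psi> \<cdot> \<alpha> = \<alpha>' \<cdot> \<psi>a"
    using KL Keq Leq gu by (auto simp: octahedron_map_def)
  have \<psi>H: "\<psi> \<in> Hom T Kc Lc" using \<psi> by simp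
  have KE: "Triangle X Y Ka u ka' ka'' \<in> Exact T" "Triangle Y Y' Kb g kb' kb'' \<in> Exact T"
      "Triangle X Y' Kc (g \<cdot> u) kc' kc'' \<in> Exact T" "Triangle Ka Kc Kb \<alpha> \<beta> \<gamma> \<in> Exact T"
    and LE: "Triangle X X' La f la' la'' \<in> Exact T" "Triangle X' Y' Lb u' lb' lb'' \<in> Exact T"
      "Triangle X Y' Lc (g \<cdot> u) lc' lc'' \<in> Exact T" "Triangle La Lc Lb \<alpha>' \<beta>' \<gamma>' \<in> Exact T"
    using Koct Loct by auto
  note \<alpha> = Exact_Hom(1)[OF KE(4)] and \<alpha>' = Exact_Hom(1)[OF LE(4)] and \<beta>' = Exact_Hom(2)[OF LE(4)]
  have "\<exists>\<alpha>\<^sub>1 \<beta>\<^sub>1 \<gamma>\<^sub>1 \<alpha>\<^sub>2 \<beta>\<^sub>2 \<gamma>\<^sub>2.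
      octahedron T (Triangle X Y Z u v w) (Triangle Y Y' Y'' g g' g'')
        (Triangle X Y' A (g \<cdot> u) vt wt) (Triangle Z A Y'' \<alpha>\<^sub>1 \<beta>\<^sub>1 \<gamma>\<^sub>1) \<and>
      octahedron T (Triangle X X' X'' f f' f'') (Triangle X' Y' Z' u' v' w')
        (Triangle X Y' A (g \<cdot> u) vt wt) (Triangle X'' A Z' \<alpha>\<^sub>2 \<beta>\<^sub>2 \<gamma>\<^sub>2) \<and>
      Zero T Z Z' = \<beta>\<^sub>2 \<cdot> \<alpha>\<^sub>1"
    if Ef: "Triangle X X' X'' f f' f'' \<in> Exact T" and Eg: "Triangle Y Y' Y'' g g' g'' \<in> Exact T"
      and EA: "Triangle X Y' A (g \<cdot> u) vt wt \<in> Exact T"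
    for X'' f' f'' Y'' g' g'' A vt wt
  proof -
    note hA = Exact_Hom[OF EA] and hK = Exact_Hom[OF KE(3)] and hL = Exact_Hom[OF LE(3)]
    obtain x where x: "triangle_map T (Triangle X Y Ka u ka' ka'') (Triangle X Y Z u v w)
        (Id T X) (Id T Y) x"
      using ex_triangle_map_Id[OF KE(1) E] by blast
    obtain y where y: "triangle_map T (Triangle Y Y' Kb g kb' kb'') (Triangle Y Y' Y'' g g' g'')
        (Id T Y) (Id T Y') y"
      using ex_triangle_map_Id[OF KE(2) Eg] by blast
    obtain r where r: "triangle_map T (Triangle X X' La f la' la'') (Triangle X X' X'' f f' f'')
        (Id T X) (Id T X') r"
      using ex_triangle_map_Id[OF LE(1) Ef] by blast
    obtain s where s: "triangle_map T (Triangle X' Y' Lb u' lb' lb'')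
        (Triangle X' Y' Z' u' v' w') (Id T X') (Id T Y') s"
      using ex_triangle_map_Id[OF LE(2) E'] by blast
    obtain z where z: "triangle_map T (Triangle X Y' Lc (g \<cdot> u) lc' lc'')
        (Triangle X Y' A (g \<cdot> u) vt wt) (Id T X) (Id T Y') z"
      using ex_triangle_map_Id[OF LE(3) EA] by blast
    have xH: "x \<in> Hom T Ka Z" and sH: "s \<in> Hom T Lb Z'" and zH: "z \<in> Hom T Lc A"
      using x s z by auto
    \<comment> \<open>This is the coordination: \<open>L\<close> is moved to the cofibre
      \<open>A\<close> along \<open>z\<close>, and \<open>K\<close> along
      \<open>z \<cdot> \<psi>\<close>, so that \<open>\<psi>\<close> becomes the identity of
      \<open>A\<close>.\<close>
    have z\<psi>: "triangle_map T (Triangle X Y' Kc (g \<cdot> u) kc' kc'')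
        (Triangle X Y' A (g \<cdot> u) vt wt) (Id T X) (Id T Y') (z \<cdot> \<psi>)"
      using z \<psi> Comp_in_Hom[OF \<psi>H zH] Comp_assoc[OF hK(2) \<psi>H zH] Comp_assoc[OF \<psi>H zH hA(3)]
        susp_Id[OF obj(1)] Id_right[OF hA(2)] Id_right[OF hL(2)] Id_left[OF hK(3)] Id_left[OF hL(3)]
      by simp
    obtain \<alpha>\<^sub>1 \<beta>\<^sub>1 \<gamma>\<^sub>1 where o1: "octahedron T (Triangle X Y Z u v w) (Triangle Y Y' Y'' g g' g'')
        (Triangle X Y' A (g \<cdot> u) vt wt) (Triangle Z A Y'' \<alpha>\<^sub>1 \<beta>\<^sub>1 \<gamma>\<^sub>1)"
      and \<alpha>\<^sub>1: "\<alpha>\<^sub>1 \<cdot> x = (z \<cdot> \<psi>) \<cdot> \<alpha>"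
      using octahedron_transport[OF Koct E Eg EA x y z\<psi>] .
    obtain \<alpha>\<^sub>2 \<beta>\<^sub>2 \<gamma>\<^sub>2 where o2: "octahedron T (Triangle X X' X'' f f' f'')
        (Triangle X' Y' Z' u' v' w') (Triangle X Y' A (g \<cdot> u) vt wt)
        (Triangle X'' A Z' \<alpha>\<^sub>2 \<beta>\<^sub>2 \<gamma>\<^sub>2)"
      and \<beta>\<^sub>2: "\<beta>\<^sub>2 \<cdot> z = s \<cdot> \<beta>'"
      using octahedron_transport[OF Loct Ef E' EA r s z] .
    have \<alpha>\<^sub>1H: "\<alpha>\<^sub>1 \<in> Hom T Z A" and \<beta>\<^sub>2H: "\<beta>\<^sub>2 \<in> Hom T A Z'"
      using o1 o2 by (auto dest: Exact_Hom)
    \<comment> \<open>Precomposing with the isomorphism \<open>x\<close> brings the composite back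
      to the original octahedra, where
      \<open>\<psi> \<cdot> \<alpha> = \<alpha>' \<cdot> \<psi>a\<close> exposes two consecutive
      maps of an exact triangle.\<close>
    have "(\<beta>\<^sub>2 \<cdot> \<alpha>\<^sub>1) \<cdot> x = (\<beta>\<^sub>2 \<cdot> z) \<cdot> (\<psi> \<cdot> \<alpha>)"
      using Comp_assoc[OF xH \<alpha>\<^sub>1H \<beta>\<^sub>2H] \<alpha>\<^sub>1 Comp_assoc[OF \<alpha> \<psi>H zH]
        Comp_assoc[OF Comp_in_Hom[OF \<alpha> \<psi>H] zH \<beta>\<^sub>2H] by simp
    also have "\<dots> = s \<cdot> ((\<beta>' \<cdot> \<alpha>') \<cdot> \<psi>a)"
      unfolding \<beta>\<^sub>2 \<psi>a(2)
      using Comp_assoc[OF Comp_in_Hom[OF \<psi>a(1) \<alpha>'] \<beta>' sH] Comp_assoc[OF \<psi>a(1) \<alpha>' \<beta>'] by simp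
    also have "\<dots> = Zero T Ka Z'"
      using Exact_Comp_Zero[OF LE(4)] Comp_Zero_left[OF \<psi>a(1)] Hom_Obj(1)[OF sH]
        Comp_Zero_right[OF Hom_Obj(1)[OF \<psi>a(1)] sH] by simp
    also have "\<dots> = Zero T Z Z' \<cdot> x"
      using Comp_Zero_left[OF xH obj(6)] by simp
    finally have "Zero T Z Z' = \<beta>\<^sub>2 \<cdot> \<alpha>\<^sub>1"
      using is_iso_cancel_right[OF triangle_map_Id_iso[OF KE(1) E x] xH
          Comp_in_Hom[OF \<alpha>\<^sub>1H \<beta>\<^sub>2H] Zero_in_Hom[OF obj(3,6)]] by simp
    with o1 o2 show ?thesis by blast
  qed
  then show ?thesis
    unfolding verdier_good.simps f_def[symmetric] g_def[symmetric] by blast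
qed

end

theorem proposition7p11:
  fixes T :: "('o, 'm, 'x) tri_cat_scheme"
  assumes "triangulated_category T"
    and "weakly_functorial_octahedra T"
    and "Triangle X Y Z u v w \<in> Exact T"
    and "Triangle X' Y' Z' u' v' w' \<in> Exact T"
    and "triangle_map T (Triangle X Y Z u v w) (Triangle X' Y' Z' u' v' w') f g (Zero T Z Z')"
    and "good T (Triangle X Y Z u v w) (Triangle X' Y' Z' u' v' w') f g (Zero T Z Z')"
  shows "verdier_good T (Triangle X Y Z u v w) (Triangle X' Y' Z' u' v' w') f g (Zero T Z Z')"
proof -
  interpret triangulated_category T by fact
  have "f \<in> Hom T X X'" "g \<in> Hom T Y Y'" using assms(5) by auto
  from good_Zero_lift[OF assms(3,4) this assms(6)]
  obtain \<theta> where "\<theta> \<in> Hom T Y X'" "\<theta> \<cdot>\<^bsub>T\<^esub> u = f" "u' \<cdot>\<^bsub>T\<^esub> \<theta> = g" .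
  then show ?thesis using lift_verdier_good[OF assms(2-4)] by blast
qed

end
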